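(* Let $\mu_1,\mu_2>0$ and let $S_1$ and $S_2$ be independent Poisson processes on $\mathbb{R}$ of rates $\mu_1$ and $\mu_2$. Then for any multi-type arrival process $\underline{A}$ (with any number $m\ge1$ of types and arbitrary distribution) independent of $(S_1,S_2)$, the multi-type departure processes $D(D(\underline{A},S_1),S_2)$ and $D(D(\underline{A},S_2),S_1)$ have the same distribution.
   Context: **Continuous-time queue.** Arrival and service processes are locally finite point configurations on $\mathbb{R}$, identified with their counting measures. Given an arrival process $A$ and a simple service process $S$, an arrival increases the queue length by 1; at each point of $S$ one customer departs if the queue is non-empty, and otherwise that point is an unused service. The queue is run from time $-\infty$: the departure process $D(A,S)$ consists of those points $t$ of $S$ such that $\sup_{s\le t}\{A([s,t])-S([s,t))\}\ge1$ (arrivals at a given time precede the service at that time). No stability assumption is made. **Multi-type queue.** An $m$-type arrival process is $\underline{A}=(A^{=1},\dots,A^{=m})$; lower class number means higher priority. Put $A^{\le r}=\sum_{i=1}^rA^{=i}$. The $m$-type departure process $D(\underline{A},S)=(D^{=1},\dots,D^{=m})$ is defined by $D^{\le r}=D(A^{\le r},S)$ for $1\le r\le m$, $D^{\le0}=0$, and $D^{=r}=D^{\le r}-D^{\le r-1}$. *)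

theory Defs
  imports "HOL-Probability.Probability"
begin

text \<open>A locally finite point configuration on the line is encoded by its multiplicity function
  \<open>f\<close>: \<open>f x\<close> is the number of points at \<open>x\<close>.  Its counting measure is \<open>B \<mapsto> points_in f B\<close>,
  used only for bounded \<open>B\<close>, where the sum is finite.  Multiple points are allowed.\<close>

type_synonym config = "real \<Rightarrow> nat"

definition configs :: "config set" where
  "configs = {f. \<forall>a b. finite {x \<in> {a..b}. f x \<noteq> 0}}"

definition points_in :: "config \<Rightarrow> real set \<Rightarrow> nat" where
  "points_in f B = (\<Sum>x\<in>{x \<in> B. f x \<noteq> 0}. f x)"

definition bounded_borel :: "real set set" where
  "bounded_borel = {B \<in> sets borel. bounded B}"

text \<open>The usual \<open>\<sigma>\<close>-algebra on configurations, generated by the counts of bounded Borel sets.\<close>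

definition config_space :: "config measure" where
  "config_space = sigma configs {{f \<in> configs. points_in f B = k} | B k. B \<in> bounded_borel}"

text \<open>The function below is total in \<open>S\<close>, although the queue is only meaningful for simple \<open>S\<close>;
  a Poisson process is almost surely simple.  The supremum may be \<open>\<infinity>\<close>, hence \<open>ereal\<close>.\<close>

definition departures :: "config \<Rightarrow> config \<Rightarrow> config" where
  "departures A S = (\<lambda>t.
     if S t > 0 \<and>
        (SUP s\<in>{..t}. ereal (real (points_in A {s..t}) - real (points_in S {s..<t}))) \<ge> 1
     then 1 else 0)"

text \<open>An \<open>m\<close>-type configuration is an element of \<open>\<Pi>\<^sub>E r\<in>{1..m}. configs\<close>; \<open>A r\<close> is the class-\<open>r\<close>
  configuration.\<close>

definition multi_space :: "nat \<Rightarrow> (nat \<Rightarrow> config) measure" where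
  "multi_space m = (\<Pi>\<^sub>M r\<in>{1..m}. config_space)"

definition upto_class :: "(nat \<Rightarrow> config) \<Rightarrow> nat \<Rightarrow> config" where
  "upto_class A r = (\<lambda>x. \<Sum>i=1..r. A i x)"

definition departures_upto :: "(nat \<Rightarrow> config) \<Rightarrow> config \<Rightarrow> nat \<Rightarrow> config" where
  "departures_upto A S r = (if r = 0 then (\<lambda>_. 0) else departures (upto_class A r) S)"

text \<open>The truncated subtraction on \<open>nat\<close> never truncates here, see
  \<open>departures_upto_mono\<close> and \<open>sum_multi_departures\<close>.\<close>

definition multi_departures :: "nat \<Rightarrow> (nat \<Rightarrow> config) \<Rightarrow> config \<Rightarrow> (nat \<Rightarrow> config)" where
  "multi_departures m A S =
     (\<lambda>r\<in>{1..m}. \<lambda>t. departures_upto A S r t - departures_upto A S (r - 1) t)"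

text \<open>Independence of random elements whose value spaces may have different types (the
  library's \<open>indep_var\<close> requires equal types).\<close>

definition indep_elements ::
  "'a measure \<Rightarrow> 'b measure \<Rightarrow> ('a \<Rightarrow> 'b) \<Rightarrow> 'c measure \<Rightarrow> ('a \<Rightarrow> 'c) \<Rightarrow> bool" where
  "indep_elements M N X N' Y \<longleftrightarrow>
     X \<in> M \<rightarrow>\<^sub>M N \<and> Y \<in> M \<rightarrow>\<^sub>M N' \<and>
     prob_space.indep_set M {X -` E \<inter> space M | E. E \<in> sets N}
                            {Y -` F \<inter> space M | F. F \<in> sets N'}"

text \<open>Measurability is part of the notion, since \<open>distr\<close> is meaningless without it.\<close>

definition same_distribution ::
  "'a measure \<Rightarrow> 'b measure \<Rightarrow> ('a \<Rightarrow> 'b) \<Rightarrow> ('a \<Rightarrow> 'b) \<Rightarrow> bool" where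
  "same_distribution M N X Y \<longleftrightarrow>
     X \<in> M \<rightarrow>\<^sub>M N \<and> Y \<in> M \<rightarrow>\<^sub>M N \<and> distr M N X = distr M N Y"

text \<open>The Poisson weights are written out because \<open>poisson_pmf\<close> requires a positive parameter,
  whereas \<open>B\<close> may be a null set (then the count is almost surely 0).\<close>

definition poisson_process :: "'a measure \<Rightarrow> real \<Rightarrow> ('a \<Rightarrow> config) \<Rightarrow> bool" where
  "poisson_process M \<mu> S \<longleftrightarrow>
     S \<in> M \<rightarrow>\<^sub>M config_space \<and>
     (\<forall>B\<in>bounded_borel. \<forall>k.
        measure M {\<omega> \<in> space M. points_in (S \<omega>) B = k} =
          (\<mu> * measure lborel B) ^ k / fact k * exp (- (\<mu> * measure lborel B))) \<and>
     (\<forall>(I :: nat set) B. finite I \<longrightarrow> B ` I \<subseteq> bounded_borel \<longrightarrow> disjoint_family_on B I \<longrightarrow>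
        prob_space.indep_vars M (\<lambda>_. count_space UNIV) (\<lambda>i \<omega>. points_in (S \<omega>) (B i)) I)"

lemma points_in_mono:
  assumes "finite {x \<in> B. g x \<noteq> 0}" and "\<And>x. f x \<le> g x"
  shows "points_in f B \<le> points_in g B"
proof -
  have "{x \<in> B. f x \<noteq> 0} \<subseteq> {x \<in> B. g x \<noteq> 0}"
    using assms(2) by (auto intro: less_le_trans)
  then have "points_in f B \<le> (\<Sum>x\<in>{x \<in> B. g x \<noteq> 0}. f x)"
    unfolding points_in_def using assms(1) by (intro sum_mono2) auto
  also have "\<dots> \<le> points_in g B"
    unfolding points_in_def by (intro sum_mono assms(2))
  finally show ?thesis .
qed

lemma departures_mono:
  assumes "B \<in> configs" and "\<And>x. A x \<le> B x"
  shows "departures A S t \<le> departures B S t"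
proof -
  have "(SUP s\<in>{..t}. ereal (real (points_in A {s..t}) - real (points_in S {s..<t})))
      \<le> (SUP s\<in>{..t}. ereal (real (points_in B {s..t}) - real (points_in S {s..<t})))"
  proof (rule SUP_mono)
    fix s assume "s \<in> {..t}"
    have "points_in A {s..t} \<le> points_in B {s..t}"
      using assms by (intro points_in_mono) (auto simp: configs_def)
    then show "\<exists>s'\<in>{..t}. ereal (real (points_in A {s..t}) - real (points_in S {s..<t}))
        \<le> ereal (real (points_in B {s'..t}) - real (points_in S {s'..<t}))"
      using \<open>s \<in> {..t}\<close> by (intro bexI[of _ s]) auto
  qed
  then show ?thesis
    by (auto simp: departures_def intro: order_trans)
qed

lemma departures_in_configs:
  assumes "S \<in> configs"
  shows "departures A S \<in> configs"
  unfolding configs_def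
proof (intro CollectI allI)
  fix a b :: real
  have "{x \<in> {a..b}. departures A S x \<noteq> 0} \<subseteq> {x \<in> {a..b}. S x \<noteq> 0}"
    by (auto simp: departures_def)
  moreover have "finite {x \<in> {a..b}. S x \<noteq> 0}"
    using assms by (auto simp: configs_def)
  ultimately show "finite {x \<in> {a..b}. departures A S x \<noteq> 0}"
    by (rule finite_subset)
qed

lemma upto_class_in_configs:
  assumes "\<And>i. i \<in> {1..r} \<Longrightarrow> A i \<in> configs"
  shows "upto_class A r \<in> configs"
  unfolding configs_def
proof (intro CollectI allI)
  fix a b :: real
  have "{x \<in> {a..b}. upto_class A r x \<noteq> 0} \<subseteq> (\<Union>i\<in>{1..r}. {x \<in> {a..b}. A i x \<noteq> 0})"
    by (auto simp: upto_class_def)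
  moreover have "finite (\<Union>i\<in>{1..r}. {x \<in> {a..b}. A i x \<noteq> 0})"
    using assms by (auto simp: configs_def)
  ultimately show "finite {x \<in> {a..b}. upto_class A r x \<noteq> 0}"
    by (rule finite_subset)
qed

lemma departures_upto_mono:
  assumes "\<And>i. i \<in> {1..Suc r} \<Longrightarrow> A i \<in> configs"
  shows "departures_upto A S r t \<le> departures_upto A S (Suc r) t"
proof (cases "r = 0")
  case False
  have "departures (upto_class A r) S t \<le> departures (upto_class A (Suc r)) S t"
    by (rule departures_mono[OF upto_class_in_configs[OF assms]]) (auto simp: upto_class_def)
  with False show ?thesis by (simp add: departures_upto_def)
qed (simp add: departures_upto_def)

lemma sum_multi_departures:
  assumes "\<And>i. i \<in> {1..m} \<Longrightarrow> A i \<in> configs" and "r \<le> m"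
  shows "upto_class (multi_departures m A S) r = departures_upto A S r"
  using assms(2)
proof (induction r)
  case 0
  show ?case by (simp add: upto_class_def departures_upto_def)
next
  case (Suc r)
  have "departures_upto A S r t \<le> departures_upto A S (Suc r) t" for t
    using assms(1) Suc.prems by (intro departures_upto_mono) auto
  moreover have "upto_class (multi_departures m A S) r t = departures_upto A S r t" for t
    using Suc by simp
  ultimately show ?case
    using Suc.prems by (auto simp: fun_eq_iff upto_class_def multi_departures_def)
qed

end

theory Submission
  imports Defs
begin

text \<open>On a window split into fine cells, a first-server point and a second-server point almost never
  share a cell, and no service shares a cell with an arrival. The window then becomes a word in the
  letters \<open>First\<close>, \<open>Second\<close>, \<open>No_Service\<close>, and with cell length \<open>h\<close> a given word has probability
  proportional to \<open>(\<mu>1 h) ^ #First * (\<mu>2 h) ^ #Second\<close>. Match each \<open>First\<close> with a later \<open>Second\<close> as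
  brackets. The unmatched letters form a block of \<open>Second\<close>s followed by a block of \<open>First\<close>s, and turning
  the last unmatched \<open>Second\<close> into a \<open>First\<close> does not change the output of the tandem queue, for any
  arrival process. Counting words along these flips shows that the law of the output is symmetric in
  \<open>\<mu>1\<close> and \<open>\<mu>2\<close>. No stationarity is needed: arrivals cut off before time \<open>-k\<close> give departures that
  increase to those of the queue run from time \<open>-\<infinity>\<close>. Since the same word serves all classes,
  the argument treats the classes jointly.\<close>

section \<open>Words of services\<close>

text \<open>For fixed services the order of the servers does matter, so equality can only come from
  a weighted count of words. Flips arrange the words in chains. With \<open>k\<close> matched pairs
  and \<open>n\<close> unmatched letters, a chain runs from \<open>n\<close> unmatched
  \<open>Second\<close>s to \<open>n\<close> unmatched \<open>First\<close>s, and its weights are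
  the products of \<open>x ^ (k + j)\<close> and \<open>y ^ (k + n - j)\<close> for
  \<open>j = 0, ..., n\<close>; exchanging \<open>x\<close> and \<open>y\<close> merely reverses the
  list. The flip is the bracketing rule of the crystal operators on words in two letters. Arrivals
  do not enter that rule, which is why they may be arbitrary.

  A word describes a window faithfully only if the arrivals and the ends of the tested intervals
  form a finite set that can be kept out of service cells. This forces three reductions: arrivals
  are held fixed, which independence and Fubini permit; they are cut off on the left; and the output
  is tested by finitely many counts at a time. Bad windows cost a probability of order
  \<open>1 / n\<close>. For several types, the output of classes at most \<open>r\<close> is a
  single-type tandem output of \<open>upto_class a r\<close>, so one flip respects all cumulative
  classes simultaneously.\<close>

datatype letter = No_Service | First | Second

text \<open>\<open>tandem w \<alpha> c d\<close> lists the departures in each step when the two queues start with \<open>c\<close> and \<open>d\<close>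
  customers and the \<open>\<alpha> j\<close> arrivals of step \<open>j\<close> precede its service.\<close>

primrec tandem :: "letter list \<Rightarrow> (nat \<Rightarrow> nat) \<Rightarrow> nat \<Rightarrow> nat \<Rightarrow> nat list" where
  "tandem [] \<alpha> c d = []"
| "tandem (l # w) \<alpha> c d =
    (let c' = c + \<alpha> 0; \<alpha>' = (\<lambda>j. \<alpha> (Suc j)) in
     case l of
       No_Service \<Rightarrow> 0 # tandem w \<alpha>' c' d
     | First \<Rightarrow> 0 # (if c' = 0 then tandem w \<alpha>' 0 d else tandem w \<alpha>' (c' - 1) (Suc d))
     | Second \<Rightarrow> (if d = 0 then 0 # tandem w \<alpha>' c' 0 else 1 # tandem w \<alpha>' c' (d - 1)))"

text \<open>The numbers of letters left over when each \<open>First\<close> is an opening and each \<open>Second\<close> a closing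
  bracket.\<close>

primrec free_second :: "letter list \<Rightarrow> nat" where
  "free_second [] = 0"
| "free_second (l # w) =
    (case l of No_Service \<Rightarrow> free_second w | First \<Rightarrow> free_second w - 1
     | Second \<Rightarrow> Suc (free_second w))"

primrec free_first :: "letter list \<Rightarrow> nat" where
  "free_first [] = 0"
| "free_first (l # w) =
    (case l of No_Service \<Rightarrow> free_first w
     | First \<Rightarrow> (if free_second w = 0 then Suc (free_first w) else free_first w)
     | Second \<Rightarrow> free_first w)"

text \<open>The unmatched letters of each word are some \<open>Second\<close>s followed by some
  \<open>First\<close>s. On concatenation only the \<open>First\<close>s of \<open>u\<close> meet
  the \<open>Second\<close>s of \<open>v\<close>, and these cancel; the truncated differences are
  what survives.\<close>

lemma free_append:
  "free_second (u @ v) = free_second u + (free_second v - free_first u)"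
  "free_first (u @ v) = free_first v + (free_first u - free_second v)"
  by (induction u) (auto split: letter.splits)

text \<open>Matched letters come in pairs, so equally many \<open>First\<close>s and
  \<open>Second\<close>s are matched.\<close>

lemma count_letters: "count_list w First + free_second w = count_list w Second + free_first w"
  by (induction w) (auto split: letter.splits)

lemma free_first_le: "free_first w \<le> count_list w First"
  by (induction w) (auto split: letter.splits)

lemma free_le_length: "count_list w First \<le> length w" "free_second w \<le> length w"
  "free_first w \<le> length w"
proof -
  show "count_list w First \<le> length w" by (rule count_le_length)
  then show "free_first w \<le> length w" using free_first_le le_trans by blast
  show "free_second w \<le> length w" by (induction w) (auto split: letter.splits)
qed

text \<open>Run both systems side by side. They differ in the place of one customer until a
  \<open>First\<close> finds the first queue of the right-hand system empty; from there on they
  coincide. Before that the bound \<open>free_second w \<le> d\<close> persists, so each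
  \<open>Second\<close> finds both second queues non-empty and both systems emit a customer.\<close>

lemma tandem_coalesce:
  assumes "free_second w \<le> d"
  shows "tandem w \<alpha> (Suc c) d = tandem w \<alpha> c (Suc d)"
  using assms
proof (induction w arbitrary: \<alpha> c d)
  case (Cons l w)
  show ?case
  proof (cases l)
    case First
    then show ?thesis
      using Cons.prems Cons.IH[of "Suc d" "\<lambda>j. \<alpha> (Suc j)" "c + \<alpha> 0 - 1"]
      by (cases "c + \<alpha> 0") (simp_all add: Let_def)
  next
    case Second
    then show ?thesis
      using Cons.prems Cons.IH[of "d - 1" "\<lambda>j. \<alpha> (Suc j)" "c + \<alpha> 0"]
      by (cases d) (simp_all add: Let_def)
  qed (use Cons in \<open>simp add: Let_def\<close>)
qed simp

text \<open>With no unmatched first service in \<open>u\<close> the second queue is empty after \<open>u\<close>, so that a second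
  service following \<open>u\<close> is unused; a first service moves at most one customer, and
  \<open>tandem_coalesce\<close> shows that this move is not visible in the output.\<close>

lemma tandem_flip_aux:
  assumes "free_first u + (d - free_second u) = 0" and "free_second v = 0"
  shows "tandem (u @ First # v) \<alpha> c d = tandem (u @ Second # v) \<alpha> c d"
  using assms(1)
\<comment> \<open>The summand \<open>d - free_second u\<close> makes the hypothesis inductive: the
  sum is \<open>free_first\<close> of \<open>u\<close> preceded by \<open>d\<close> letters
  \<open>First\<close>, and it bounds the content of the second queue after
  \<open>u\<close>.\<close>
proof (induction u arbitrary: \<alpha> c d)
  case Nil
  then show ?case
    using tandem_coalesce[of v 0 _ "c + \<alpha> 0 - 1"] assms(2) by (auto simp: Let_def)
next
  case (Cons l u)
  then show ?case
    by (cases l) (auto simp: Let_def split: if_splits intro!: Cons.IH)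
qed

text \<open>The two conditions make the changed letter the last unmatched \<open>Second\<close> of
  \<open>w\<close> and the leftmost unmatched \<open>First\<close> of \<open>w'\<close>. Being
  canonical on both sides, the flip can be inverted.\<close>

definition flip :: "letter list \<Rightarrow> letter list \<Rightarrow> bool" where
  "flip w w' \<longleftrightarrow> (\<exists>u v. w = u @ Second # v \<and> w' = u @ First # v
     \<and> free_first u = 0 \<and> free_second v = 0)"

lemma flip_tandem: "flip w w' \<Longrightarrow> tandem w \<alpha> 0 0 = tandem w' \<alpha> 0 0"
  by (auto simp: flip_def tandem_flip_aux)

lemma flip_length: "flip w w' \<Longrightarrow> length w = length w'"
  by (auto simp: flip_def)

lemma flip_nth_No_Service:
  "flip w w' \<Longrightarrow> w ! j = No_Service \<longleftrightarrow> w' ! j = No_Service"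
  by (auto simp: flip_def nth_append nth_Cons split: nat.splits)

lemma flip_free:
  assumes "flip w w'"
  shows "free_second w = Suc (free_second w')" "free_first w' = Suc (free_first w)"
    "count_list w' First = Suc (count_list w First)"
  using assms by (auto simp: flip_def free_append)

text \<open>Let \<open>z\<close> be the stretch between two candidate places. If
  \<open>a = First\<close>, the earlier letter must be matched by a \<open>Second\<close> that is
  free in \<open>z\<close>, and this one is also free in \<open>v\<close>. If
  \<open>a = Second\<close>, the later letter must be matched by a \<open>First\<close> that is free
  in \<open>z\<close>, and this one is also free in \<open>u'\<close>.\<close>

lemma flip_unique_aux:
  assumes "u @ a # v = u' @ a # v'" and "free_first u = 0" "free_second v = 0"
    and "free_first u' = 0" "free_second v' = 0" and "a = First \<or> a = Second"
    and "length u < length u'"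
  shows False
proof -
  obtain z where z: "u' = u @ a # z" "v = z @ a # v'"
    using assms(1,7) by (auto simp: append_eq_append_conv2 append_eq_Cons_conv Cons_eq_append_conv)
  show ?thesis
    using assms(2-6) unfolding z by (auto simp: free_append)
qed

lemma flip_unique:
  assumes "u @ a # v = u' @ a # v'" and "free_first u = 0" "free_second v = 0"
    and "free_first u' = 0" "free_second v' = 0" and "a = First \<or> a = Second"
  shows "u = u' \<and> v = v'"
  using flip_unique_aux[OF assms] flip_unique_aux[OF assms(1)[symmetric] assms(4,5,2,3,6)] assms(1)
  by (metis append_eq_append_conv linorder_neqE_nat list.inject)

lemma flip_right_unique: "flip w w' \<Longrightarrow> flip w w'' \<Longrightarrow> w' = w''"
  unfolding flip_def using flip_unique by blast

lemma flip_left_unique: "flip w' w \<Longrightarrow> flip w'' w \<Longrightarrow> w' = w''"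
  unfolding flip_def using flip_unique by blast

lemma flip_total:
  assumes "free_second w > 0" shows "\<exists>w'. flip w w'"
proof -
  \<comment> \<open>The value of \<open>free_second u\<close> is carried along for the induction: a
    new head \<open>First\<close> must find its partner inside \<open>u\<close>, and it does, since
    \<open>free_second (First # w) > 0\<close> means \<open>free_second w \<ge> 2\<close>.\<close>
  have "\<exists>u v. w = u @ Second # v \<and> free_first u = 0 \<and> free_second v = 0
      \<and> free_second u = free_second w - 1"
    using assms
  proof (induction w)
    case (Cons l w)
    show ?case
    proof (cases "free_second w = 0")
      case True
      with Cons.prems have "l = Second" by (auto split: letter.splits)
      with True show ?thesis by (intro exI[of _ "[]"] exI[of _ w]) auto
    next
      case False
      with Cons obtain u v where uv: "w = u @ Second # v" "free_first u = 0" "free_second v = 0"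
        "free_second u = free_second w - 1" by auto
      have "l # w = (l # u) @ Second # v" using uv(1) by simp
      moreover have "free_first (l # u) = 0" "free_second (l # u) = free_second (l # w) - 1"
        using uv(2,4) False Cons.prems by (cases l; simp)+
      ultimately show ?thesis using uv(3) by blast
    qed
  qed simp
  then show ?thesis unfolding flip_def by blast
qed

lemma flip_surj:
  assumes "free_first w > 0" shows "\<exists>w'. flip w' w"
proof -
  have "\<exists>u v. w = u @ First # v \<and> free_first u = 0 \<and> free_second v = 0
      \<and> free_second u = free_second w"
    using assms
  proof (induction w)
    case (Cons l w)
    show ?case
    proof (cases "free_first w = 0")
      case True
      with Cons.prems have "l = First" "free_second w = 0" by (auto split: letter.splits if_splits)
      with True show ?thesis by (intro exI[of _ "[]"] exI[of _ w]) auto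
    next
      case False
      with Cons obtain u v where uv: "w = u @ First # v" "free_first u = 0" "free_second v = 0"
        "free_second u = free_second w" by auto
      show ?thesis
      \<comment> \<open>A head \<open>First\<close> without a partner is itself the leftmost
        unmatched one. A head \<open>First\<close> with a partner finds one inside \<open>u\<close>,
        because \<open>free_second u = free_second w\<close>.\<close>
      proof (cases "l = First \<and> free_second w = 0")
        case True
        with uv show ?thesis by (intro exI[of _ "[]"] exI[of _ w]) auto
      next
        case False
        have "l # w = (l # u) @ First # v" using uv(1) by simp
        moreover have "free_first (l # u) = 0" "free_second (l # u) = free_second (l # w)"
          using uv(2,4) False by (cases l; simp)+
        ultimately show ?thesis using uv(3) by blast
      qed
    qed
  qed simp
  then show ?thesis unfolding flip_def by blast
qed

lemma sum_words_swap:
  fixes x y :: real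
  assumes W: "finite W" and flip: "\<And>w w'. flip w w' \<Longrightarrow> w \<in> W \<longleftrightarrow> w' \<in> W"
  shows "(\<Sum>w\<in>W. x ^ count_list w First * y ^ count_list w Second)
       = (\<Sum>w\<in>W. y ^ count_list w First * x ^ count_list w Second)"
proof -
  txt \<open>A flip preserves the number \<open>k\<close> of matched pairs and moves \<open>(Suc i, j)\<close> to \<open>(i, Suc j)\<close>, so
    that the size of \<open>C k i j\<close> depends only on \<open>k\<close> and \<open>i + j\<close>.\<close>
  define C where "C k i j =
    {w \<in> W. count_list w First - free_first w = k \<and> free_second w = i \<and> free_first w = j}" for k i j
  have shift: "card (C k (Suc i) j) = card (C k i (Suc j))" for k i j
  proof -
    have "bij_betw (\<lambda>w. THE w'. flip w w') (C k (Suc i) j) (C k i (Suc j))"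
    proof (rule bij_betw_imageI)
      have the: "(THE w'. flip w w') = w'" if "flip w w'" for w w'
        using that flip_right_unique by blast
      show "inj_on (\<lambda>w. THE w'. flip w w') (C k (Suc i) j)"
      proof (rule inj_onI)
        fix w1 w2 assume w12: "w1 \<in> C k (Suc i) j" "w2 \<in> C k (Suc i) j"
          "(THE w'. flip w1 w') = (THE w'. flip w2 w')"
        then obtain w1' w2' where *: "flip w1 w1'" "flip w2 w2'"
          using flip_total[of w1] flip_total[of w2] by (auto simp: C_def)
        with w12(3) have "w1' = w2'" by (simp add: the)
        with * show "w1 = w2" using flip_left_unique by blast
      qed
      show "(\<lambda>w. THE w'. flip w w') ` C k (Suc i) j = C k i (Suc j)"
      proof (intro equalityI subsetI)
        fix w' assume "w' \<in> (\<lambda>w. THE w'. flip w w') ` C k (Suc i) j"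
        then obtain w where w: "w \<in> C k (Suc i) j" "w' = (THE w'. flip w w')" by blast
        then obtain w'' where "flip w w''" using flip_total[of w] by (auto simp: C_def)
        with w(2) have "flip w w'" by (simp add: the)
        with w(1) show "w' \<in> C k i (Suc j)"
          using flip[of w w'] flip_free[of w w'] by (auto simp: C_def)
      next
        fix w' assume w': "w' \<in> C k i (Suc j)"
        then obtain w where w: "flip w w'" using flip_surj[of w'] by (auto simp: C_def)
        then have "w \<in> C k (Suc i) j"
          using flip[OF w] flip_free[OF w] w' by (auto simp: C_def)
        then show "w' \<in> (\<lambda>w. THE w'. flip w w') ` C k (Suc i) j"
          using the[OF w] by (metis imageI)
      qed
    qed
    then show ?thesis by (rule bij_betw_same_card)
  qed
  have all: "card (C k (n + i) j) = card (C k i (n + j))" for k n i j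
  proof (induction n arbitrary: j)
    case (Suc n)
    then show ?case using shift[of k "n + i" j] Suc[of "Suc j"] by simp
  qed simp
  \<comment> \<open>Flipping as long as possible takes both sides to
    \<open>C k 0 (i + j)\<close>.\<close>
  have symm: "card (C k i j) = card (C k j i)" for k i j
    using all[of k i 0 j] all[of k j 0 i] all[of k i j 0] all[of k j i 0] by (simp add: add.commute)
  obtain N where N: "\<And>w. w \<in> W \<Longrightarrow> length w \<le> N"
    using W by (metis finite_imageI finite_nat_set_iff_bounded_le imageI)
  have expand: "(\<Sum>w\<in>W. g w) = (\<Sum>k\<le>N. \<Sum>i\<le>N. \<Sum>j\<le>N. real (card (C k i j)) * h k i j)"
    if g: "\<And>k i j w. w \<in> C k i j \<Longrightarrow> g w = h k i j"
    for g :: "letter list \<Rightarrow> real" and h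
  proof -
    have "(\<Sum>w\<in>W. g w) = (\<Sum>(k, i, j)\<in>{..N} \<times> {..N} \<times> {..N}. \<Sum>w\<in>C k i j. g w)"
    proof (subst sum.group[where g = "\<lambda>w. (count_list w First - free_first w, free_second w, free_first w)",
          OF W, symmetric])
      show "(\<lambda>w. (count_list w First - free_first w, free_second w, free_first w)) ` W
          \<subseteq> {..N} \<times> {..N} \<times> {..N}"
      proof (rule image_subsetI)
        fix w assume "w \<in> W"
        then have "length w \<le> N" by (rule N)
        then show "(count_list w First - free_first w, free_second w, free_first w)
            \<in> {..N} \<times> {..N} \<times> {..N}"
          using free_le_length[of w] by auto
      qed
    qed (auto intro!: sum.cong simp: C_def)
    also have "\<dots> = (\<Sum>(k, i, j)\<in>{..N} \<times> {..N} \<times> {..N}. real (card (C k i j)) * h k i j)"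
      using g by (intro sum.cong) auto
    also have "\<dots> = (\<Sum>k\<le>N. \<Sum>i\<le>N. \<Sum>j\<le>N. real (card (C k i j)) * h k i j)"
      by (simp add: sum.cartesian_product[symmetric])
    finally show ?thesis .
  qed
  have cnt: "count_list w First = k + j" "count_list w Second = k + i" if "w \<in> C k i j" for w k i j
    using that free_first_le[of w] count_letters[of w] by (auto simp: C_def)
  have "(\<Sum>w\<in>W. x ^ count_list w First * y ^ count_list w Second)
      = (\<Sum>k\<le>N. \<Sum>i\<le>N. \<Sum>j\<le>N. real (card (C k i j)) * (x ^ (k + j) * y ^ (k + i)))"
    by (rule expand) (simp add: cnt)
  \<comment> \<open>By \<open>symm\<close>, exchanging the summation indices \<open>i\<close> and
    \<open>j\<close> amounts to exchanging the exponents of \<open>x\<close> and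
    \<open>y\<close>.\<close>
  also have "\<dots> = (\<Sum>k\<le>N. \<Sum>j\<le>N. \<Sum>i\<le>N. real (card (C k j i)) * (y ^ (k + i) * x ^ (k + j)))"
    by (subst sum.swap) (simp add: symm mult.commute)
  also have "\<dots> = (\<Sum>w\<in>W. y ^ count_list w First * x ^ count_list w Second)"
    by (rule expand[symmetric]) (simp add: cnt)
  finally show ?thesis .
qed

section \<open>Configurations and their counts\<close>

lemma finite_points: "f \<in> configs \<Longrightarrow> bounded B \<Longrightarrow> finite {x \<in> B. f x \<noteq> 0}"
proof -
  assume f: "f \<in> configs" and "bounded B"
  then obtain a where "\<forall>x\<in>B. \<bar>x\<bar> \<le> a" by (auto simp: bounded_iff)
  then have "{x \<in> B. f x \<noteq> 0} \<subseteq> {x \<in> {-a..a}. f x \<noteq> 0}" by (auto simp: abs_le_iff)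
  then show ?thesis using f by (auto simp: configs_def intro: finite_subset)
qed

lemma points_in_empty [simp]: "points_in f {} = 0"
  by (simp add: points_in_def)

lemma points_in_singleton [simp]: "points_in f {x} = f x"
proof (cases "f x = 0")
  case False
  then have "{y \<in> {x}. f y \<noteq> 0} = {x}" by auto
  then show ?thesis by (simp add: points_in_def)
qed (simp add: points_in_def)

lemma points_in_superset:
  assumes "finite F" "{x \<in> B. f x \<noteq> 0} \<subseteq> F" "F \<subseteq> B"
  shows "points_in f B = sum f F"
  unfolding points_in_def using assms by (intro sum.mono_neutral_left) auto

lemma points_in_Un:
  assumes "f \<in> configs" "bounded B" "bounded C" "B \<inter> C = {}"
  shows "points_in f (B \<union> C) = points_in f B + points_in f C"
proof -
  have "{x \<in> B \<union> C. f x \<noteq> 0} = {x \<in> B. f x \<noteq> 0} \<union> {x \<in> C. f x \<noteq> 0}" by auto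
  then show ?thesis
    unfolding points_in_def using finite_points[OF assms(1)] assms(2-4)
    by (simp add: sum.union_disjoint disjoint_iff)
qed

lemma points_in_UN:
  assumes "f \<in> configs" "finite I" "\<And>i. i \<in> I \<Longrightarrow> bounded (B i)" "disjoint_family_on B I"
  shows "points_in f (\<Union>i\<in>I. B i) = (\<Sum>i\<in>I. points_in f (B i))"
  using assms(2,3,4)
proof (induction I rule: finite_induct)
  case (insert i I)
  have "B i \<inter> (\<Union>i\<in>I. B i) = {}"
    using insert.hyps insert.prems(2) by (fastforce simp: disjoint_family_on_def)
  then have "points_in f (\<Union>i\<in>insert i I. B i) = points_in f (B i) + points_in f (\<Union>i\<in>I. B i)"
    using points_in_Un[of f "B i" "\<Union>i\<in>I. B i"] insert assms(1) by (simp add: bounded_UN)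
  also have "points_in f (\<Union>i\<in>I. B i) = (\<Sum>i\<in>I. points_in f (B i))"
    using insert.prems by (intro insert.IH) (auto simp: disjoint_family_on_def)
  finally show ?case using insert.hyps by simp
qed simp

lemma points_in_eq_0: "f \<in> configs \<Longrightarrow> bounded B \<Longrightarrow> points_in f B = 0 \<longleftrightarrow> (\<forall>x\<in>B. f x = 0)"
  using finite_points[of f B] by (auto simp: points_in_def)

lemma points_in_subset:
  assumes "f \<in> configs" "bounded C" "B \<subseteq> C"
  shows "points_in f B \<le> points_in f C"
  unfolding points_in_def using assms finite_points[of f C] by (intro sum_mono2) auto

lemma points_in_split:
  assumes "f \<in> configs" "s \<le> t" "t \<le> u"
  shows "points_in f {s..<u} = points_in f {s..<t} + points_in f {t..<u}"
  using points_in_Un[of f "{s..<t}" "{t..<u}"] assms by (simp add: ivl_disj_un disjoint_iff)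

lemma points_in_Icc:
  assumes "f \<in> configs" "s \<le> t"
  shows "points_in f {s..t} = points_in f {s..<t} + f t"
proof -
  have "{s..t} = {s..<t} \<union> {t}" using assms(2) by auto
  then show ?thesis using points_in_Un[of f "{s..<t}" "{t}"] assms(1) by simp
qed

lemma points_in_diff:
  assumes "f \<in> configs" "bounded B" "\<And>x. g x \<le> f x"
  shows "points_in (\<lambda>x. f x - g x) B = points_in f B - points_in g B"
proof -
  let ?F = "{x \<in> B. f x \<noteq> 0}"
  have 1: "points_in (\<lambda>x. f x - g x) B = (\<Sum>x\<in>?F. f x - g x)"
    using assms finite_points by (intro points_in_superset) auto
  have "f x \<noteq> 0" if "g x \<noteq> 0" for x using that assms(3)[of x] by simp
  then have 2: "points_in g B = (\<Sum>x\<in>?F. g x)"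
    using finite_points[OF assms(1,2)] by (intro points_in_superset) (auto simp del: neq0_conv)
  show ?thesis
    unfolding 1 2 points_in_def[of f] by (rule sum_subtractf_nat) (rule assms(3))
qed

lemma points_in_sum:
  assumes "\<And>i. i \<in> I \<Longrightarrow> f i \<in> configs" "finite I" "bounded B"
  shows "points_in (\<lambda>x. \<Sum>i\<in>I. f i x) B = (\<Sum>i\<in>I. points_in (f i) B)"
proof -
  let ?F = "\<Union>i\<in>I. {x \<in> B. f i x \<noteq> 0}"
  have F: "finite ?F" using assms finite_points by auto
  have "{x \<in> B. (\<Sum>i\<in>I. f i x) \<noteq> 0} \<subseteq> ?F"
    by (auto simp del: neq0_conv sum_eq_0_iff elim!: sum.not_neutral_contains_not_neutral)
  then have "points_in (\<lambda>x. \<Sum>i\<in>I. f i x) B = (\<Sum>x\<in>?F. \<Sum>i\<in>I. f i x)"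
    using F by (intro points_in_superset) auto
  also have "\<dots> = (\<Sum>i\<in>I. \<Sum>x\<in>?F. f i x)" by (rule sum.swap)
  also have "\<dots> = (\<Sum>i\<in>I. points_in (f i) B)"
    using F by (intro sum.cong refl points_in_superset[symmetric]) auto
  finally show ?thesis .
qed

text \<open>The differences are integers, so their supremum, finite or not, reaches 1 exactly when
  one of them is positive. A witness \<open>s\<close> thus replaces the extended-real
  supremum.\<close>

lemma departures_iff:
  "departures A S t = (if S t > 0 \<and> (\<exists>s\<le>t. points_in S {s..<t} < points_in A {s..t}) then 1 else 0)"
proof -
  define g where "g s = real (points_in A {s..t}) - real (points_in S {s..<t})" for s
  have "1 \<le> (SUP s\<in>{..t}. ereal (g s)) \<longleftrightarrow> (\<exists>s\<le>t. g s > 0)"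
  proof
    assume *: "1 \<le> (SUP s\<in>{..t}. ereal (g s))"
    show "\<exists>s\<le>t. g s > 0"
    proof (rule ccontr)
      assume "\<not> (\<exists>s\<le>t. g s > 0)"
      then have "(SUP s\<in>{..t}. ereal (g s)) \<le> 0" by (intro SUP_least) (auto simp: not_less)
      with * have "1 \<le> (0::ereal)" by (rule order_trans)
      then show False by simp
    qed
  next
    assume "\<exists>s\<le>t. g s > 0"
    then obtain s where s: "s \<le> t" "g s > 0" by blast
    then have "points_in S {s..<t} + 1 \<le> points_in A {s..t}" by (simp add: g_def)
    then have "1 \<le> g s" unfolding g_def by linarith
    then have "1 \<le> ereal (g s)" by (simp only: one_ereal_def ereal_less_eq)
    also have "\<dots> \<le> (SUP s\<in>{..t}. ereal (g s))" using s(1) by (intro SUP_upper) simp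
    finally show "1 \<le> (SUP s\<in>{..t}. ereal (g s))" .
  qed
  also have "(\<exists>s\<le>t. g s > 0) \<longleftrightarrow> (\<exists>s\<le>t. points_in S {s..<t} < points_in A {s..t})"
    by (simp add: g_def)
  finally have "1 \<le> (SUP s\<in>{..t}. ereal (g s))
      \<longleftrightarrow> (\<exists>s\<le>t. points_in S {s..<t} < points_in A {s..t})" .
  then show ?thesis unfolding departures_def g_def by (simp only:)
qed

lemma departures_le_1: "departures A S t \<le> 1"
  by (simp add: departures_iff)

lemma configs_subset:
  assumes "f \<in> configs" "\<And>x. g x \<noteq> 0 \<Longrightarrow> f x \<noteq> 0"
  shows "g \<in> configs"
  unfolding configs_def
proof (intro CollectI allI)
  fix a b :: real
  have "{x \<in> {a..b}. g x \<noteq> 0} \<subseteq> {x \<in> {a..b}. f x \<noteq> 0}" using assms(2) by blast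
  moreover have "finite {x \<in> {a..b}. f x \<noteq> 0}" using assms(1) by (simp add: configs_def)
  ultimately show "finite {x \<in> {a..b}. g x \<noteq> 0}" by (rule finite_subset)
qed

lemma eventually_no_points_right:
  assumes "f \<in> configs"
  shows "\<exists>d>0. \<forall>x. t < x \<and> x < t + d \<longrightarrow> f x = 0"
proof -
  let ?F = "{x \<in> {t..t+1}. f x \<noteq> 0} - {t}"
  have "finite ?F" using assms by (simp add: configs_def)
  from finite_set_avoid[OF this, of t]
  obtain d where d: "d > 0" "\<forall>x\<in>?F. d \<le> dist t x" by fastforce
  show ?thesis
  proof (intro exI[of _ "min d 1"] conjI allI impI)
    fix x assume x: "t < x \<and> x < t + min d 1"
    show "f x = 0"
    proof (rule ccontr)
      assume "f x \<noteq> 0"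
      moreover have "min d 1 \<le> d" "min d 1 \<le> 1" by simp_all
      ultimately have "x \<in> ?F" using x by auto
      with d(2) have "d \<le> dist t x" by blast
      with x show False by (auto simp: dist_real_def min_def split: if_splits)
    qed
  qed (use d in auto)
qed

lemma eventually_no_points_left:
  assumes "f \<in> configs"
  shows "\<exists>d>0. \<forall>x. t - d < x \<and> x < t \<longrightarrow> f x = 0"
proof -
  let ?F = "{x \<in> {t-1..t}. f x \<noteq> 0} - {t}"
  have "finite ?F" using assms by (simp add: configs_def)
  from finite_set_avoid[OF this, of t]
  obtain d where d: "d > 0" "\<forall>x\<in>?F. d \<le> dist t x" by fastforce
  show ?thesis
  proof (intro exI[of _ "min d 1"] conjI allI impI)
    fix x assume x: "t - min d 1 < x \<and> x < t"
    show "f x = 0"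
    proof (rule ccontr)
      assume "f x \<noteq> 0"
      moreover have "min d 1 \<le> d" "min d 1 \<le> 1" by simp_all
      ultimately have "x \<in> ?F" using x by auto
      with d(2) have "d \<le> dist t x" by blast
      with x show False by (auto simp: dist_real_def min_def split: if_splits)
    qed
  qed (use d in auto)
qed

section \<open>Measurable maps into the space of configurations\<close>

lemma space_config_space [simp]: "space config_space = configs"
  unfolding config_space_def by (rule space_measure_of) auto

lemma bounded_borel_Ico [simp]: "{u..<v} \<in> bounded_borel"
  by (simp add: bounded_borel_def)

lemma measurable_points_in [measurable]:
  assumes "B \<in> bounded_borel"
  shows "(\<lambda>f. points_in f B) \<in> config_space \<rightarrow>\<^sub>M count_space UNIV"
proof -
  have "{f \<in> configs. points_in f B = k} \<in> sets config_space" for k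
    unfolding config_space_def
    by (subst sets_measure_of) (use assms in \<open>auto intro!: sigma_sets.Basic\<close>)
  then show ?thesis
    by (auto simp: measurable_count_space_eq2_countable vimage_def Int_def conj_commute)
qed

text \<open>Convergence in a discrete space: \<open>g\<close> has the value \<open>k\<close> where
  all but finitely many \<open>f n\<close> have it, which is a countable combination of measurable
  sets.\<close>

lemma measurable_eventually_eq:
  fixes f :: "nat \<Rightarrow> 'a \<Rightarrow> nat"
  assumes [measurable]: "\<And>n. f n \<in> N \<rightarrow>\<^sub>M count_space UNIV"
    and ev: "\<And>\<omega>. \<omega> \<in> space N \<Longrightarrow> eventually (\<lambda>n. f n \<omega> = g \<omega>) sequentially"
  shows "g \<in> N \<rightarrow>\<^sub>M count_space UNIV"
proof -
  have "g -` {k} \<inter> space N = {\<omega> \<in> space N. \<exists>n0. \<forall>n\<ge>n0. f n \<omega> = k}" for k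
  proof (intro equalityI subsetI)
    fix \<omega> assume "\<omega> \<in> g -` {k} \<inter> space N"
    then show "\<omega> \<in> {\<omega> \<in> space N. \<exists>n0. \<forall>n\<ge>n0. f n \<omega> = k}"
      using ev[of \<omega>] by (auto simp: eventually_sequentially)
  next
    fix \<omega> assume "\<omega> \<in> {\<omega> \<in> space N. \<exists>n0. \<forall>n\<ge>n0. f n \<omega> = k}"
    then obtain n0 where \<omega>: "\<omega> \<in> space N" "\<forall>n\<ge>n0. f n \<omega> = k" by auto
    obtain n1 where "\<forall>n\<ge>n1. f n \<omega> = g \<omega>" using ev[OF \<omega>(1)] by (auto simp: eventually_sequentially)
    with \<omega> have "g \<omega> = k" by (metis max.cobounded1 max.cobounded2)
    with \<omega> show "\<omega> \<in> g -` {k} \<inter> space N" by simp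
  qed
  moreover have "{\<omega> \<in> space N. \<exists>n0. \<forall>n\<ge>n0. f n \<omega> = k} \<in> sets N" for k
    by measurable
  ultimately show ?thesis
    by (simp add: measurable_count_space_eq2_countable)
qed

lemma Int_stable_Ico: "Int_stable (range (\<lambda>(a, b). {a..<b::real}))"
  by (auto simp: Int_stable_def)

text \<open>Half-open intervals are an intersection-stable generator of the Borel sets, and a Dynkin
  argument passes from them to all bounded Borel sets.\<close>

lemma measurable_configI:
  assumes X: "X \<in> space N \<rightarrow> configs"
    and Ico: "\<And>u v. u \<le> v \<Longrightarrow> (\<lambda>\<omega>. points_in (X \<omega>) {u..<v}) \<in> N \<rightarrow>\<^sub>M count_space UNIV"
  shows "X \<in> N \<rightarrow>\<^sub>M config_space"
proof -
  have Ico': "(\<lambda>\<omega>. points_in (X \<omega>) {u..<v}) \<in> N \<rightarrow>\<^sub>M count_space UNIV" for u v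
    using Ico[of u v] by (cases "u \<le> v") simp_all
  \<comment> \<open>Intersecting with a bounded window keeps the counts finite, so that complements
    turn into differences; the Dynkin induction itself runs over unbounded sets.\<close>
  have inter: "(\<lambda>\<omega>. points_in (X \<omega>) (B \<inter> {-c..<c})) \<in> N \<rightarrow>\<^sub>M count_space UNIV"
    if "B \<in> sets borel" for B and c :: real
  proof -
    have bd: "bounded (B' \<inter> {-c..<c})" for B' by (rule bounded_subset[of "{-c..<c}"]) auto
    have "B \<in> sigma_sets UNIV (range (\<lambda>(a, b). {a..<b::real}))"
      using that unfolding borel_eq_atLeastLessThan by simp
    with Int_stable_Ico have "Int_stable (range (\<lambda>(a, b). {a..<b::real}))"
      "range (\<lambda>(a, b). {a..<b::real}) \<subseteq> Pow UNIV"
      "B \<in> sigma_sets UNIV (range (\<lambda>(a, b). {a..<b::real}))"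
      by auto
    then show ?thesis
    proof (induction rule: sigma_sets_induct_disjoint)
      case (basic B)
      then show ?case by (auto intro: Ico')
    next
      case (compl B)
      have "points_in (X \<omega>) ((UNIV - B) \<inter> {-c..<c})
          = points_in (X \<omega>) {-c..<c} - points_in (X \<omega>) (B \<inter> {-c..<c})" if "\<omega> \<in> space N" for \<omega>
      proof -
        have "{-c..<c} = (UNIV - B) \<inter> {-c..<c} \<union> B \<inter> {-c..<c}" by auto
        then have "points_in (X \<omega>) {-c..<c}
          = points_in (X \<omega>) ((UNIV - B) \<inter> {-c..<c}) + points_in (X \<omega>) (B \<inter> {-c..<c})"
          using X that bd by (subst points_in_Un[symmetric]) auto
        then show ?thesis by simp
      qed
      moreover have "(\<lambda>\<omega>. points_in (X \<omega>) {-c..<c} - points_in (X \<omega>) (B \<inter> {-c..<c}))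
          \<in> N \<rightarrow>\<^sub>M count_space UNIV"
        using compl Ico'[of "-c" c] by measurable
      ultimately show ?case by (simp cong: measurable_cong)
    next
      case (union B)
      show ?case
      proof (rule measurable_eventually_eq[where f = "\<lambda>n \<omega>. \<Sum>i<n. points_in (X \<omega>) (B i \<inter> {-c..<c})"])
        show "(\<lambda>\<omega>. \<Sum>i<n. points_in (X \<omega>) (B i \<inter> {-c..<c})) \<in> N \<rightarrow>\<^sub>M count_space UNIV" for n
          using union by (induction n) auto
        fix \<omega> assume "\<omega> \<in> space N"
        with X have \<omega>: "X \<omega> \<in> configs" by auto
        \<comment> \<open>Only the finitely many points of \<open>F\<close> are counted, and each
          lies in some \<open>B i\<close>; hence the partial sums become constant.\<close>
        define F where "F = {x \<in> \<Union>(range B) \<inter> {-c..<c}. X \<omega> x \<noteq> 0}"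
        have F: "finite F" unfolding F_def by (rule finite_points[OF \<omega> bd])
        have "\<forall>x\<in>F. \<exists>i. x \<in> B i" by (auto simp: F_def)
        then obtain ix where ix: "\<forall>x\<in>F. x \<in> B (ix x)" by metis
        obtain n0 where n0: "\<forall>x\<in>F. ix x < n0"
          using F by (metis finite_imageI finite_nat_set_iff_bounded imageI)
        have "(\<Sum>i<n. points_in (X \<omega>) (B i \<inter> {-c..<c})) = points_in (X \<omega>) (\<Union>(range B) \<inter> {-c..<c})"
          if "n \<ge> n0" for n
        proof -
          have "(\<Sum>i<n. points_in (X \<omega>) (B i \<inter> {-c..<c}))
              = points_in (X \<omega>) (\<Union>i<n. B i \<inter> {-c..<c})"
            using \<omega> bd union(1) by (intro points_in_UN[symmetric])
              (auto simp: disjoint_family_on_def)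
          also have "\<dots> = (\<Sum>x\<in>F. X \<omega> x)"
            using F n0 ix that by (intro points_in_superset) (force simp: F_def)+
          also have "\<dots> = points_in (X \<omega>) (\<Union>(range B) \<inter> {-c..<c})"
            by (simp add: points_in_def F_def)
          finally show ?thesis .
        qed
        then show "\<forall>\<^sub>F n in sequentially. (\<Sum>i<n. points_in (X \<omega>) (B i \<inter> {-c..<c}))
            = points_in (X \<omega>) (\<Union>(range B) \<inter> {-c..<c})"
          by (auto simp: eventually_sequentially)
      qed
    qed simp_all
  qed
  show ?thesis
    unfolding config_space_def
  proof (rule measurable_measure_of)
    fix Y assume "Y \<in> {{f \<in> configs. points_in f B = k} | B k. B \<in> bounded_borel}"
    then obtain B k where Y: "Y = {f \<in> configs. points_in f B = k}" "B \<in> bounded_borel" by blast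
    then obtain c where c: "\<forall>x\<in>B. \<bar>x\<bar> \<le> c" by (auto simp: bounded_borel_def bounded_iff)
    \<comment> \<open>The window is open on the right and \<open>c\<close> may belong to
      \<open>B\<close>, hence \<open>c + 1\<close>.\<close>
    have "B \<inter> {-(c+1)..<c+1} = B" using c by (fastforce simp: abs_le_iff)
    then have [measurable]: "(\<lambda>\<omega>. points_in (X \<omega>) B) \<in> N \<rightarrow>\<^sub>M count_space UNIV"
      using inter[of B "c+1"] Y by (simp add: bounded_borel_def)
    have "X -` Y \<inter> space N = {\<omega> \<in> space N. points_in (X \<omega>) B = k}"
      using X by (auto simp: Y)
    also have "\<dots> \<in> sets N" by measurable
    finally show "X -` Y \<inter> space N \<in> sets N" .
  qed (use X in auto)
qed

section \<open>Measurability of the departure process\<close>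

definition grid :: "real \<Rightarrow> real \<Rightarrow> nat \<Rightarrow> nat \<Rightarrow> real" where
  "grid a b n j = a + real j * ((b - a) / real n)"

definition cell :: "real \<Rightarrow> real \<Rightarrow> nat \<Rightarrow> nat \<Rightarrow> real set" where
  "cell a b n j = {grid a b n j..<grid a b n (Suc j)}"

lemma grid_0 [simp]: "grid a b n 0 = a"
  by (simp add: grid_def)

lemma grid_n: "n > 0 \<Longrightarrow> grid a b n n = b"
  by (simp add: grid_def)

lemma grid_mono: "a \<le> b \<Longrightarrow> i \<le> j \<Longrightarrow> grid a b n i \<le> grid a b n j"
  unfolding grid_def by (intro add_left_mono mult_right_mono) auto

lemma grid_Suc: "grid a b n (Suc j) = grid a b n j + (b - a) / real n"
  by (simp add: grid_def algebra_simps add_divide_distrib diff_divide_distrib)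

lemma bounded_cell [simp]: "bounded (cell a b n j)"
  by (simp add: cell_def)

lemma bounded_borel_cell [simp]: "cell a b n j \<in> bounded_borel"
  by (simp add: cell_def)

lemma disjoint_cells:
  assumes "a \<le> b" shows "disjoint_family_on (cell a b n) I"
proof -
  have lt: "cell a b n i \<inter> cell a b n j = {}" if "i < j" for i j
    using grid_mono[OF assms, of "Suc i" j n] that by (auto simp: cell_def)
  have "cell a b n i \<inter> cell a b n j = {}" if "i \<noteq> j" for i j
    using lt[of i j] lt[of j i] that by (cases "i < j") auto
  then show ?thesis by (simp add: disjoint_family_on_def)
qed

lemma UN_cells:
  assumes "a \<le> b" "n > 0" shows "(\<Union>j<n. cell a b n j) = {a..<b}"
proof -
  have "(\<Union>j<k. cell a b n j) = {a..<grid a b n k}" for k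
  proof (induction k)
    case (Suc k)
    have "a \<le> grid a b n k" "grid a b n k \<le> grid a b n (Suc k)"
      using grid_mono[OF assms(1), of 0 k n] grid_mono[OF assms(1), of k "Suc k" n] by simp_all
    with Suc show ?case by (simp add: lessThan_Suc cell_def Un_commute ivl_disj_un_two)
  qed simp
  from this[of n] assms(2) show ?thesis by (simp add: grid_n)
qed

lemma points_in_cells:
  assumes "f \<in> configs" "a \<le> b" "n > 0"
  shows "points_in f {a..<b} = (\<Sum>j<n. points_in f (cell a b n j))"
  using points_in_UN[OF assms(1), of "{..<n}" "cell a b n"] disjoint_cells[OF assms(2)]
  by (simp add: UN_cells[OF assms(2,3)])

text \<open>A witness \<open>s\<close> can be moved left to a rational in the service-free gap
  before it: the service count is unchanged and the arrival count can only grow. Besides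
  countability this yields a witness strictly before \<open>t\<close>.\<close>

lemma departures_rat_iff:
  assumes A: "A \<in> configs" and S: "S \<in> configs"
  shows "departures A S t = 1 \<longleftrightarrow> S t > 0 \<and>
    (\<exists>q::rat. of_rat q < t \<and> points_in S {of_rat q..<t} < points_in A {of_rat q..t})"
proof
  assume "departures A S t = 1"
  then obtain s where s: "S t > 0" "s \<le> t" "points_in S {s..<t} < points_in A {s..t}"
    by (auto simp: departures_iff split: if_splits)
  obtain d where d: "d > 0" "\<forall>x. s - d < x \<and> x < s \<longrightarrow> S x = 0"
    using eventually_no_points_left[OF S] by blast
  obtain q :: rat where q: "s - d < of_rat q" "of_rat q < s"
    using of_rat_dense[of "s - d" s] d(1) by auto
  have "points_in S {of_rat q..<t} = points_in S {of_rat q..<s} + points_in S {s..<t}"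
    using q(2) s(2) by (intro points_in_split[OF S]) auto
  also have "points_in S {of_rat q..<s} = 0"
    using d(2) q by (subst points_in_eq_0[OF S]) auto
  also have "points_in A {s..t} \<le> points_in A {of_rat q..t}"
    using q(2) by (intro points_in_subset[OF A]) auto
  ultimately show "S t > 0 \<and>
    (\<exists>q::rat. of_rat q < t \<and> points_in S {of_rat q..<t} < points_in A {of_rat q..t})"
    using s q(2) by (intro conjI exI[of _ q]) auto
next
  assume "S t > 0 \<and>
    (\<exists>q::rat. of_rat q < t \<and> points_in S {of_rat q..<t} < points_in A {of_rat q..t})"
  then show "departures A S t = 1" by (auto simp: departures_iff intro: less_imp_le)
qed

text \<open>Evaluating the departure condition at the end points of a sufficiently fine cell instead of at
  the service point leaves only countably many counts of intervals with fixed end points.\<close>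

definition cell_departure :: "config \<Rightarrow> config \<Rightarrow> real \<Rightarrow> real \<Rightarrow> bool" where
  "cell_departure A S e e' \<longleftrightarrow> points_in S {e..<e'} > 0 \<and>
     (\<exists>q::rat. of_rat q < e \<and> points_in S {of_rat q..<e} < points_in A {of_rat q..<e'})"

text \<open>In a short enough cell around the service point \<open>t\<close> there is no other
  service and no arrival after \<open>t\<close>, and if \<open>t\<close> is a departure then some
  witness lies to the left of the cell. The four bounds behind \<open>d\<close> secure exactly
  this.\<close>

lemma cell_departure_iff:
  assumes A: "A \<in> configs" and S: "S \<in> configs" and "S t > 0"
  shows "\<exists>d>0. \<forall>e e'. e \<le> t \<and> t < e' \<and> e' - e < d \<longrightarrow>
    (cell_departure A S e e' \<longleftrightarrow> departures A S t = 1) \<and> (\<forall>x\<in>{e..<e'} - {t}. S x = 0)"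
proof -
  obtain d1 where d1: "d1 > 0" "\<forall>x. t < x \<and> x < t + d1 \<longrightarrow> S x = 0"
    using eventually_no_points_right[OF S] by blast
  obtain d2 where d2: "d2 > 0" "\<forall>x. t - d2 < x \<and> x < t \<longrightarrow> S x = 0"
    using eventually_no_points_left[OF S] by blast
  obtain d3 where d3: "d3 > 0" "\<forall>x. t < x \<and> x < t + d3 \<longrightarrow> A x = 0"
    using eventually_no_points_right[OF A] by blast
  obtain d4 where d4: "d4 > 0" "departures A S t = 1 \<Longrightarrow>
    \<exists>q::rat. of_rat q < t - d4 \<and> points_in S {of_rat q..<t} < points_in A {of_rat q..t}"
  proof (cases "departures A S t = 1")
    case True
    then obtain q :: rat where q: "of_rat q < t" "points_in S {of_rat q..<t} < points_in A {of_rat q..t}"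
      using departures_rat_iff[OF A S] by blast
    \<comment> \<open>Half the gap keeps \<open>q\<close> strictly before \<open>t - d4\<close>, and
      so before the left end of every cell that is considered.\<close>
    show ?thesis
      by (rule that[of "(t - of_rat q) / 2"]) (use q in \<open>auto intro!: exI[of _ q] simp: field_simps\<close>)
  qed (use that[of 1] in auto)
  define d where "d = min (min d1 d2) (min d3 d4)"
  have d: "d > 0" "d \<le> d1" "d \<le> d2" "d \<le> d3" "d \<le> d4"
    using d1(1) d2(1) d3(1) d4(1) by (auto simp: d_def)
  have "(cell_departure A S e e' \<longleftrightarrow> departures A S t = 1) \<and> (\<forall>x\<in>{e..<e'} - {t}. S x = 0)"
    if e: "e \<le> t" "t < e'" "e' - e < d" for e e'
  proof -
    have only: "S x = 0" if "x \<in> {e..<e'}" "x \<noteq> t" for x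
    proof (cases "x < t")
      case True
      with that e d have "t - d2 < x" by auto
      with True d2(2) show ?thesis by blast
    next
      case False
      with that e d have "t < x" "x < t + d1" by auto
      with d1(2) show ?thesis by blast
    qed
    have noA: "A x = 0" if "x \<in> {t<..<e'}" for x
    proof -
      from that e d have "t < x" "x < t + d3" by auto
      with d3(2) show ?thesis by blast
    qed
    have S0: "points_in S {e..<t} = 0"
      using only e by (subst points_in_eq_0[OF S]) auto
    have Spos: "points_in S {e..<e'} > 0"
      using points_in_eq_0[OF S, of "{e..<e'}"] assms(3) e by (auto simp del: neq0_conv simp: neq0_conv[symmetric])
    have Aeq: "points_in A {s..<e'} = points_in A {s..t}" if "s \<le> t" for s
    proof -
      have "{s..<e'} = {s..t} \<union> {t<..<e'}" using that e by auto
      then have "points_in A {s..<e'} = points_in A {s..t} + points_in A {t<..<e'}"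
        by (simp only:) (rule points_in_Un[OF A], auto)
      moreover have "points_in A {t<..<e'} = 0" using noA by (subst points_in_eq_0[OF A]) auto
      ultimately show ?thesis by simp
    qed
    have Seq: "points_in S {s..<t} = points_in S {s..<e}" if "s \<le> e" for s
      using points_in_split[OF S that e(1)] S0 by simp
    have eq: "(points_in S {of_rat q..<e} < points_in A {of_rat q..<e'})
        = (points_in S {of_rat q..<t} < points_in A {of_rat q..t})" if "of_rat q < e" for q :: rat
      using Seq[of "of_rat q"] Aeq[of "of_rat q"] e(1) that by simp
    have "cell_departure A S e e' \<longleftrightarrow>
        (\<exists>q::rat. of_rat q < e \<and> points_in S {of_rat q..<t} < points_in A {of_rat q..t})"
      unfolding cell_departure_def using Spos by (simp add: eq cong: conj_cong)
    also have "\<dots> \<longleftrightarrow> departures A S t = 1"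
    proof
      assume "\<exists>q::rat. of_rat q < e \<and> points_in S {of_rat q..<t} < points_in A {of_rat q..t}"
      then show "departures A S t = 1"
        using departures_rat_iff[OF A S] assms(3) e(1) by (meson order_less_le_trans)
    next
      assume "departures A S t = 1"
      then obtain q :: rat where q: "of_rat q < t - d4"
        "points_in S {of_rat q..<t} < points_in A {of_rat q..t}" using d4(2) by blast
      have "t - d4 < e" using e d by linarith
      with q show "\<exists>q::rat. of_rat q < e \<and> points_in S {of_rat q..<t} < points_in A {of_rat q..t}"
        by (intro exI[of _ q]) auto
    qed
    finally show ?thesis using only by blast
  qed
  with d(1) show ?thesis by blast
qed

lemma points_in_single:
  assumes "x \<in> B" "\<And>y. y \<in> B \<Longrightarrow> y \<noteq> x \<Longrightarrow> f y = 0"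
  shows "points_in f B = f x"
  using points_in_superset[of "{x}" B f] assms by fastforce

text \<open>The window holds finitely many services, so one grid is fine enough for all of them; a
  cell without service contributes 0 on both sides. Using \<open>Suc n\<close> avoids a grid of no
  cells.\<close>

lemma eventually_cell_departures:
  assumes A: "A \<in> configs" and S: "S \<in> configs" and "u \<le> v"
  shows "eventually (\<lambda>n. (\<Sum>j<Suc n. of_bool (cell_departure A S (grid u v (Suc n) j) (grid u v (Suc n) (Suc j))))
    = points_in (departures A S) {u..<v}) sequentially"
proof -
  define F where "F = {x \<in> {u..<v}. S x \<noteq> 0}"
  have F: "finite F" unfolding F_def by (rule finite_points[OF S]) simp
  have "\<forall>t\<in>F. \<exists>d>0. \<forall>e e'. e \<le> t \<and> t < e' \<and> e' - e < d \<longrightarrow>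
    (cell_departure A S e e' \<longleftrightarrow> departures A S t = 1) \<and> (\<forall>x\<in>{e..<e'} - {t}. S x = 0)"
    using cell_departure_iff[OF A S] by (auto simp: F_def)
  then obtain d where d: "\<And>t. t \<in> F \<Longrightarrow> d t > 0"
    "\<And>t e e'. t \<in> F \<Longrightarrow> e \<le> t \<Longrightarrow> t < e' \<Longrightarrow> e' - e < d t \<Longrightarrow>
    (cell_departure A S e e' \<longleftrightarrow> departures A S t = 1) \<and> (\<forall>x\<in>{e..<e'} - {t}. S x = 0)"
    by metis
  have "(\<lambda>n. (v - u) * inverse (real (Suc n))) \<longlonglongrightarrow> (v - u) * 0"
    by (intro tendsto_mult tendsto_const LIMSEQ_inverse_real_of_nat)
  then have lim: "(\<lambda>n. (v - u) / real (Suc n)) \<longlonglongrightarrow> 0" by (simp add: field_simps)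
  have "eventually (\<lambda>n. \<forall>t\<in>F. (v - u) / real (Suc n) < d t) sequentially"
    using F d(1) by (intro eventually_ball_finite ballI order_tendstoD(2)[OF lim]) auto
  then show ?thesis
  proof (rule eventually_mono)
    fix n assume n: "\<forall>t\<in>F. (v - u) / real (Suc n) < d t"
    have "of_bool (cell_departure A S (grid u v (Suc n) j) (grid u v (Suc n) (Suc j)))
      = points_in (departures A S) (cell u v (Suc n) j)" if "j < Suc n" for j
    proof (cases "points_in S (cell u v (Suc n) j) = 0")
      case True
      then have "\<forall>x\<in>cell u v (Suc n) j. S x = 0" by (simp add: points_in_eq_0[OF S])
      then have "points_in (departures A S) (cell u v (Suc n) j) = 0"
        by (subst points_in_eq_0[OF departures_in_configs[OF S]]) (auto simp: departures_iff)
      moreover have "\<not> cell_departure A S (grid u v (Suc n) j) (grid u v (Suc n) (Suc j))"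
        using True by (simp add: cell_departure_def cell_def)
      ultimately show ?thesis by simp
    next
      case False
      then obtain t where t: "t \<in> cell u v (Suc n) j" "S t \<noteq> 0"
        by (auto simp: points_in_eq_0[OF S] simp del: neq0_conv)
      have "t \<in> (\<Union>j<Suc n. cell u v (Suc n) j)" using t(1) that by blast
      then have "t \<in> F" using t(2) UN_cells[OF assms(3), of "Suc n"] by (auto simp: F_def)
      with n have "grid u v (Suc n) (Suc j) - grid u v (Suc n) j < d t"
        by (simp add: grid_Suc del: of_nat_Suc)
      with d(2)[OF \<open>t \<in> F\<close>] t(1)
      have *: "cell_departure A S (grid u v (Suc n) j) (grid u v (Suc n) (Suc j)) \<longleftrightarrow> departures A S t = 1"
        "\<forall>x\<in>cell u v (Suc n) j - {t}. S x = 0"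
        unfolding cell_def by (metis atLeastLessThan_iff)+
      from *(2) have "points_in (departures A S) (cell u v (Suc n) j) = departures A S t"
        by (intro points_in_single[OF t(1)]) (auto simp: departures_iff)
      with *(1) departures_le_1[of A S t] show ?thesis by (auto simp: le_Suc_eq)
    qed
    then show "(\<Sum>j<Suc n. of_bool (cell_departure A S (grid u v (Suc n) j) (grid u v (Suc n) (Suc j))))
      = points_in (departures A S) {u..<v}"
      by (simp add: points_in_cells[OF departures_in_configs[OF S] assms(3), of "Suc n"] del: sum.lessThan_Suc)
  qed
qed

lemma measurable_sum_nat:
  fixes f :: "'i \<Rightarrow> 'a \<Rightarrow> nat"
  assumes "\<And>i. i \<in> I \<Longrightarrow> f i \<in> N \<rightarrow>\<^sub>M count_space UNIV"
  shows "(\<lambda>\<omega>. \<Sum>i\<in>I. f i \<omega>) \<in> N \<rightarrow>\<^sub>M count_space UNIV"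
  using assms by (induction I rule: infinite_finite_induct) auto

lemma measurable_less_nat:
  fixes f g :: "'a \<Rightarrow> nat"
  assumes f: "f \<in> N \<rightarrow>\<^sub>M count_space UNIV" and g: "g \<in> N \<rightarrow>\<^sub>M count_space UNIV"
  shows "Measurable.pred N (\<lambda>\<omega>. f \<omega> < g \<omega>)"
  by (rule measurable_compose_countable[OF _ f]) (rule measurable_compose[OF g], simp)

lemma measurable_departures:
  assumes X [measurable]: "X \<in> N \<rightarrow>\<^sub>M config_space" and Y [measurable]: "Y \<in> N \<rightarrow>\<^sub>M config_space"
  shows "(\<lambda>\<omega>. departures (X \<omega>) (Y \<omega>)) \<in> N \<rightarrow>\<^sub>M config_space"
proof (rule measurable_configI)
  have X': "X \<omega> \<in> configs" and Y': "Y \<omega> \<in> configs" if "\<omega> \<in> space N" for \<omega>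
    using measurable_space[OF X that] measurable_space[OF Y that] by simp_all
  then show "(\<lambda>\<omega>. departures (X \<omega>) (Y \<omega>)) \<in> space N \<rightarrow> configs"
    by (auto intro: departures_in_configs)
  fix u v :: real assume "u \<le> v"
  show "(\<lambda>\<omega>. points_in (departures (X \<omega>) (Y \<omega>)) {u..<v}) \<in> N \<rightarrow>\<^sub>M count_space UNIV"
  proof (rule measurable_eventually_eq[where f = "\<lambda>n \<omega>. \<Sum>j<Suc n.
      of_bool (cell_departure (X \<omega>) (Y \<omega>) (grid u v (Suc n) j) (grid u v (Suc n) (Suc j)))"])
    have [measurable]: "(\<lambda>\<omega>. points_in (X \<omega>) {s..<t}) \<in> N \<rightarrow>\<^sub>M count_space UNIV"
      "(\<lambda>\<omega>. points_in (Y \<omega>) {s..<t}) \<in> N \<rightarrow>\<^sub>M count_space UNIV" for s t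
      using measurable_compose[OF X measurable_points_in] measurable_compose[OF Y measurable_points_in]
      by simp_all
    have [measurable]: "Measurable.pred N (\<lambda>\<omega>. points_in (Y \<omega>) {s..<t} < points_in (X \<omega>) {s'..<t'})"
      for s t s' t' by (rule measurable_less_nat) measurable
    have "Measurable.pred N (\<lambda>\<omega>. points_in (Y \<omega>) {s..<t} > 0)" for s t
      by (rule measurable_less_nat) measurable
    moreover have "Measurable.pred N (\<lambda>\<omega>. \<exists>q::rat. of_rat q < e \<and>
        points_in (Y \<omega>) {of_rat q..<e} < points_in (X \<omega>) {of_rat q..<e'})" for e e'
      by (intro pred_intros_countable pred_intros_conj1') measurable
    ultimately have "Measurable.pred N (\<lambda>\<omega>. cell_departure (X \<omega>) (Y \<omega>) e e')" for e e'
      unfolding cell_departure_def by (rule pred_intros_logic)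
    then have "(\<lambda>\<omega>. of_bool (cell_departure (X \<omega>) (Y \<omega>) e e') :: nat) \<in> N \<rightarrow>\<^sub>M count_space UNIV" for e e'
      by (rule measurable_compose) simp
    then show "(\<lambda>\<omega>. \<Sum>j<Suc n. of_bool (cell_departure (X \<omega>) (Y \<omega>)
        (grid u v (Suc n) j) (grid u v (Suc n) (Suc j))) :: nat) \<in> N \<rightarrow>\<^sub>M count_space UNIV" for n
      by (intro measurable_sum_nat) auto
  qed (rule eventually_cell_departures[OF X' Y' \<open>u \<le> v\<close>])
qed

section \<open>Measurability of the multi-type departure process\<close>

lemma measurable_upto_class:
  assumes X: "X \<in> N \<rightarrow>\<^sub>M multi_space m" and "r \<le> m"
  shows "(\<lambda>\<omega>. upto_class (X \<omega>) r) \<in> N \<rightarrow>\<^sub>M config_space"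
proof -
  have comp: "(\<lambda>\<omega>. X \<omega> i) \<in> N \<rightarrow>\<^sub>M config_space" if "i \<in> {1..r}" for i
    using X measurable_component_singleton[of i "{1..m}" "\<lambda>_. config_space"] that \<open>r \<le> m\<close>
    unfolding multi_space_def by (auto intro: measurable_compose)
  have conf: "X \<omega> i \<in> configs" if "\<omega> \<in> space N" "i \<in> {1..r}" for \<omega> i
    using measurable_space[OF comp that(1)] that(2) by simp
  show ?thesis
  proof (rule measurable_configI)
    show "(\<lambda>\<omega>. upto_class (X \<omega>) r) \<in> space N \<rightarrow> configs"
      using conf by (auto intro: upto_class_in_configs)
    fix u v :: real
    have "(\<lambda>\<omega>. \<Sum>i\<in>{1..r}. points_in (X \<omega> i) {u..<v}) \<in> N \<rightarrow>\<^sub>M count_space UNIV"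
      using comp by (intro measurable_sum_nat) (auto intro: measurable_compose[OF _ measurable_points_in])
    moreover have "points_in (upto_class (X \<omega>) r) {u..<v} = (\<Sum>i\<in>{1..r}. points_in (X \<omega> i) {u..<v})"
      if "\<omega> \<in> space N" for \<omega>
      unfolding upto_class_def using conf[OF that] by (intro points_in_sum) auto
    ultimately show "(\<lambda>\<omega>. points_in (upto_class (X \<omega>) r) {u..<v}) \<in> N \<rightarrow>\<^sub>M count_space UNIV"
      by (simp cong: measurable_cong)
  qed
qed

lemma departures_zero: "departures (\<lambda>_. 0) S = (\<lambda>_. 0)"
  by (simp add: fun_eq_iff departures_iff points_in_def)

lemma departures_upto_eq: "departures_upto A S r = departures (upto_class A r) S"
  by (cases "r = 0") (simp_all add: departures_upto_def upto_class_def departures_zero)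

lemma multi_space_configs:
  "a \<in> space (multi_space m) \<Longrightarrow> i \<in> {1..m} \<Longrightarrow> a i \<in> configs"
  by (auto simp: multi_space_def space_PiM PiE_def)

text \<open>Monotonicity in the class excludes truncation at every point, so counts may be
  subtracted as well.\<close>

lemma points_in_multi_departures:
  assumes a: "a \<in> space (multi_space m)" and S: "S \<in> configs" and r: "r \<in> {1..m}" and "bounded B"
  shows "points_in (multi_departures m a S r) B
    = points_in (departures (upto_class a r) S) B - points_in (departures (upto_class a (r - 1)) S) B"
proof -
  obtain k where k: "r = Suc k" using r by (cases r) auto
  have "points_in (\<lambda>t. departures (upto_class a r) S t - departures (upto_class a (r - 1)) S t) B
    = points_in (departures (upto_class a r) S) B - points_in (departures (upto_class a (r - 1)) S) B"
    using departures_upto_mono[of k a S] multi_space_configs[OF a] r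
    by (intro points_in_diff departures_in_configs S assms(4)) (auto simp: k departures_upto_eq)
  then show ?thesis using r by (simp add: multi_departures_def departures_upto_eq)
qed

lemma multi_departures_in_configs:
  assumes S: "S \<in> configs" and r: "r \<in> {1..m}"
  shows "multi_departures m a S r \<in> configs"
  using departures_in_configs[OF S, of "upto_class a r"] r
  by (rule_tac configs_subset) (auto simp: multi_departures_def departures_upto_eq)

lemma measurable_multi_departures:
  assumes X: "X \<in> N \<rightarrow>\<^sub>M multi_space m" and Y: "Y \<in> N \<rightarrow>\<^sub>M config_space"
  shows "(\<lambda>\<omega>. multi_departures m (X \<omega>) (Y \<omega>)) \<in> N \<rightarrow>\<^sub>M multi_space m"
proof -
  have Y': "Y \<omega> \<in> configs" if "\<omega> \<in> space N" for \<omega> using measurable_space[OF Y that] by simp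
  have "(\<lambda>\<omega>. multi_departures m (X \<omega>) (Y \<omega>) r) \<in> N \<rightarrow>\<^sub>M config_space" if r: "r \<in> {1..m}" for r
  proof (rule measurable_configI)
    show "(\<lambda>\<omega>. multi_departures m (X \<omega>) (Y \<omega>) r) \<in> space N \<rightarrow> configs"
      using multi_departures_in_configs[OF Y' r] by auto
    fix u v :: real
    have [measurable]: "(\<lambda>\<omega>. points_in (departures (upto_class (X \<omega>) k) (Y \<omega>)) {u..<v}) \<in> N \<rightarrow>\<^sub>M count_space UNIV"
      if "k \<le> m" for k
      using measurable_departures[OF measurable_upto_class[OF X that] Y]
      by (rule measurable_compose[OF _ measurable_points_in]) simp
    have "r \<le> m" "r - 1 \<le> m" using r by auto
    then have "(\<lambda>\<omega>. points_in (departures (upto_class (X \<omega>) r) (Y \<omega>)) {u..<v}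
        - points_in (departures (upto_class (X \<omega>) (r - 1)) (Y \<omega>)) {u..<v}) \<in> N \<rightarrow>\<^sub>M count_space UNIV"
      by measurable
    then show "(\<lambda>\<omega>. points_in (multi_departures m (X \<omega>) (Y \<omega>) r) {u..<v}) \<in> N \<rightarrow>\<^sub>M count_space UNIV"
      using points_in_multi_departures[OF measurable_space[OF X] Y' r, where B = "{u..<v}"]
      by (simp cong: measurable_cong)
  qed
  then have "(\<lambda>\<omega>. \<lambda>r\<in>{1..m}. multi_departures m (X \<omega>) (Y \<omega>) r) \<in> N \<rightarrow>\<^sub>M multi_space m"
    unfolding multi_space_def by (rule measurable_restrict)
  moreover have "(\<lambda>r\<in>{1..m}. multi_departures m a S r) = multi_departures m a S" for a S
    by (auto simp: multi_departures_def restrict_def)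
  ultimately show ?thesis by simp
qed

section \<open>Tandem queues on a window\<close>

text \<open>The queue started from time \<open>-\<infinity>\<close> holds \<open>q\<close> customers just before time \<open>t\<close>.\<close>

definition in_queue :: "config \<Rightarrow> config \<Rightarrow> real \<Rightarrow> nat \<Rightarrow> bool" where
  "in_queue A S t q \<longleftrightarrow> (\<forall>s\<le>t. points_in A {s..<t} \<le> points_in S {s..<t} + q)
     \<and> (\<exists>s\<le>t. points_in A {s..<t} = points_in S {s..<t} + q)"

lemma in_queue_empty:
  assumes "A \<in> configs" "\<And>x. x < t \<Longrightarrow> A x = 0"
  shows "in_queue A S t 0"
proof -
  have "points_in A {s..<t} = 0" for s using assms by (subst points_in_eq_0) auto
  then show ?thesis by (auto simp: in_queue_def intro!: exI[of _ t])
qed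

lemma in_queue_no_service:
  assumes A: "A \<in> configs" and S: "S \<in> configs" and "e \<le> e'" and q: "in_queue A S e q"
    and S0: "points_in S {e..<e'} = 0"
  shows "in_queue A S e' (q + points_in A {e..<e'})" "points_in (departures A S) {e..<e'} = 0"
proof -
  have split: "points_in A {s..<e'} = points_in A {s..<e} + points_in A {e..<e'}"
    "points_in S {s..<e'} = points_in S {s..<e}" if "s \<le> e" for s
    using points_in_split[OF A that \<open>e \<le> e'\<close>] points_in_split[OF S that \<open>e \<le> e'\<close>] S0 by simp_all
  show "in_queue A S e' (q + points_in A {e..<e'})"
    unfolding in_queue_def
  proof (intro conjI allI impI)
    fix s assume "s \<le> e'"
    show "points_in A {s..<e'} \<le> points_in S {s..<e'} + (q + points_in A {e..<e'})"
    proof (cases "s \<le> e")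
      case True
      then show ?thesis using q split[OF True] by (auto simp: in_queue_def)
    next
      case False
      then have "points_in A {s..<e'} \<le> points_in A {e..<e'}" by (intro points_in_subset[OF A]) auto
      then show ?thesis by simp
    qed
  next
    obtain s where s: "s \<le> e" "points_in A {s..<e} = points_in S {s..<e} + q"
      using q by (auto simp: in_queue_def)
    then show "\<exists>s\<le>e'. points_in A {s..<e'} = points_in S {s..<e'} + (q + points_in A {e..<e'})"
      using split[OF s(1)] \<open>e \<le> e'\<close> by (intro exI[of _ s]) auto
  qed
  have "\<forall>x\<in>{e..<e'}. S x = 0" using S0 by (simp add: points_in_eq_0[OF S])
  then show "points_in (departures A S) {e..<e'} = 0"
    by (subst points_in_eq_0[OF departures_in_configs[OF S]]) (auto simp: departures_iff)
qed

text \<open>Without arrivals in the interval, the position of its single service is immaterial: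
  starting points after \<open>e\<close> see no arrival, and earlier ones see the balance at
  \<open>e\<close>. The truncated \<open>q - 1\<close> covers a service that finds the queue
  empty.\<close>

lemma in_queue_service:
  assumes A: "A \<in> configs" and S: "S \<in> configs" and "e \<le> e'" and q: "in_queue A S e q"
    and A0: "points_in A {e..<e'} = 0" and S1: "points_in S {e..<e'} = 1"
  shows "in_queue A S e' (q - 1)" "points_in (departures A S) {e..<e'} = of_bool (q > 0)"
proof -
  have splitA: "points_in A {s..<e'} = points_in A {s..<e}"
    and splitS: "points_in S {s..<e'} = points_in S {s..<e} + 1" if "s \<le> e" for s
    using points_in_split[OF A that \<open>e \<le> e'\<close>] points_in_split[OF S that \<open>e \<le> e'\<close>] A0 S1 by simp_all
  have late: "points_in A {s..<t} = 0" if "e \<le> s" "t \<le> e'" for s t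
  proof -
    have "points_in A {s..<t} \<le> points_in A {e..<e'}"
      using that by (intro points_in_subset[OF A]) auto
    then show ?thesis using A0 by simp
  qed
  show "in_queue A S e' (q - 1)"
    unfolding in_queue_def
  proof (intro conjI allI impI)
    fix s assume "s \<le> e'"
    show "points_in A {s..<e'} \<le> points_in S {s..<e'} + (q - 1)"
    proof (cases "s \<le> e")
      case True
      then have "points_in A {s..<e} \<le> points_in S {s..<e} + q" using q by (auto simp: in_queue_def)
      then show ?thesis using splitA[OF True] splitS[OF True] by linarith
    next
      case False
      then show ?thesis using late[of s e'] by simp
    qed
  next
    show "\<exists>s\<le>e'. points_in A {s..<e'} = points_in S {s..<e'} + (q - 1)"
    proof (cases "q = 0")
      case True
      \<comment> \<open>For an empty queue the maximum is attained by the empty interval at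
        \<open>e'\<close>.\<close>
      then show ?thesis by (intro exI[of _ e']) simp
    next
      case False
      obtain s where s: "s \<le> e" "points_in A {s..<e} = points_in S {s..<e} + q"
        using q by (auto simp: in_queue_def)
      then show ?thesis
        using splitA[OF s(1)] splitS[OF s(1)] \<open>e \<le> e'\<close> False by (intro exI[of _ s]) auto
    qed
  qed
  obtain t where t: "t \<in> {e..<e'}" "S t \<noteq> 0"
    using S1 points_in_eq_0[OF S, of "{e..<e'}"] by force
  have S': "points_in S {e..<e'} = points_in S {e..<t} + points_in S {t..<e'}"
    using t(1) by (intro points_in_split[OF S]) auto
  have "points_in S {t} \<le> points_in S {t..<e'}"
    using t(1) by (intro points_in_subset[OF S]) auto
  with S' S1 t(2) have S0: "points_in S {e..<t} = 0" by simp
  have single: "S x = 0" if "x \<in> {e..<e'}" "x \<noteq> t" for x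
  proof -
    have "points_in S {x, t} \<le> points_in S {e..<e'}"
      using that t(1) by (intro points_in_subset[OF S]) auto
    moreover have "points_in S {x, t} = S x + S t"
      using points_in_Un[OF S, of "{x}" "{t}"] that by (simp add: insert_commute)
    ultimately show ?thesis using S1 t(2) by simp
  qed
  have "points_in (departures A S) {e..<e'} = departures A S t"
    using single by (intro points_in_single[OF t(1)]) (auto simp: departures_iff)
  also have "departures A S t = of_bool (q > 0)"
  proof -
    have At: "A t = 0" using A0 t(1) points_in_eq_0[OF A, of "{e..<e'}"] by auto
    have AS: "points_in A {s..t} = points_in A {s..<e}" "points_in S {s..<t} = points_in S {s..<e}"
      if "s \<le> e" for s
      using points_in_Icc[OF A, of s t] points_in_split[OF A that, of t] points_in_split[OF S that, of t]
        late[of e t] t(1) At S0 that by simp_all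
    have "(\<exists>s\<le>t. points_in S {s..<t} < points_in A {s..t}) \<longleftrightarrow> q > 0"
    proof
      assume "\<exists>s\<le>t. points_in S {s..<t} < points_in A {s..t}"
      then obtain s where s: "s \<le> t" "points_in S {s..<t} < points_in A {s..t}" by blast
      have "s \<le> e"
      proof (rule ccontr)
        assume "\<not> s \<le> e"
        then have "points_in A {s..t} = 0"
          using points_in_Icc[OF A s(1)] late[of s t] t(1) At by simp
        with s(2) show False by simp
      qed
      with s(2) AS[OF this] have "points_in S {s..<e} < points_in A {s..<e}" by simp
      moreover have "points_in A {s..<e} \<le> points_in S {s..<e} + q"
        using q \<open>s \<le> e\<close> by (auto simp: in_queue_def)
      ultimately show "q > 0" by simp
    next
      assume "q > 0"
      moreover obtain s where s: "s \<le> e" "points_in A {s..<e} = points_in S {s..<e} + q"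
        using q by (auto simp: in_queue_def)
      ultimately show "\<exists>s\<le>t. points_in S {s..<t} < points_in A {s..t}"
        using AS[OF s(1)] t(1) by (intro exI[of _ s]) auto
    qed
    then show ?thesis using t(2) by (simp add: departures_iff)
  qed
  finally show "points_in (departures A S) {e..<e'} = of_bool (q > 0)" .
qed

text \<open>The states \<open>c\<close> and \<open>d\<close> are the actual queue lengths at the
  left ends of the cells. No cell holds both a service and an arrival to that server's queue:
  external arrivals avoid service cells, and departures of the first queue fall into
  \<open>First\<close> cells, which hold no second service. Hence the order of events inside a cell
  cannot matter.\<close>

lemma tandem_counts_aux:
  assumes A: "A \<in> configs" and S1: "S1 \<in> configs" and S2: "S2 \<in> configs"
    and g: "\<And>j. g j \<le> g (Suc j)"
    and "in_queue A S1 (g 0) c" and "in_queue (departures A S1) S2 (g 0) d"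
    and "\<And>j. j < length w \<Longrightarrow> points_in S1 {g j..<g (Suc j)} = of_bool (w ! j = First)"
    and "\<And>j. j < length w \<Longrightarrow> points_in S2 {g j..<g (Suc j)} = of_bool (w ! j = Second)"
    and "\<And>j. j < length w \<Longrightarrow> w ! j \<noteq> No_Service \<Longrightarrow> points_in A {g j..<g (Suc j)} = 0"
  shows "tandem w (\<lambda>j. points_in A {g j..<g (Suc j)}) c d
    = map (\<lambda>j. points_in (departures (departures A S1) S2) {g j..<g (Suc j)}) [0..<length w]"
  using assms(4-)
proof (induction w arbitrary: g c d)
  case Nil
  show ?case by simp
next
  case (Cons l w)
  let ?D = "departures A S1"
  have D: "?D \<in> configs" by (rule departures_in_configs[OF S1])
  note g0 = Cons.prems(1)[of 0]
  have S1l: "points_in S1 {g 0..<g (Suc 0)} = of_bool (l = First)"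
    and S2l: "points_in S2 {g 0..<g (Suc 0)} = of_bool (l = Second)"
    and Al: "l \<noteq> No_Service \<Longrightarrow> points_in A {g 0..<g (Suc 0)} = 0"
    using Cons.prems(4)[of 0] Cons.prems(5)[of 0] Cons.prems(6)[of 0] by simp_all
  have IH: "tandem w (\<lambda>j. points_in A {g (Suc j)..<g (Suc (Suc j))}) c' d'
      = map (\<lambda>j. points_in (departures ?D S2) {g (Suc j)..<g (Suc (Suc j))}) [0..<length w]"
    if "in_queue A S1 (g (Suc 0)) c'" "in_queue ?D S2 (g (Suc 0)) d'" for c' d'
  proof (rule Cons.IH[where g = "\<lambda>j. g (Suc j)"])
    fix j assume "j < length w"
    then show "points_in S1 {g (Suc j)..<g (Suc (Suc j))} = of_bool (w ! j = First)"
      "points_in S2 {g (Suc j)..<g (Suc (Suc j))} = of_bool (w ! j = Second)"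
      "w ! j \<noteq> No_Service \<Longrightarrow> points_in A {g (Suc j)..<g (Suc (Suc j))} = 0"
      using Cons.prems(4)[of "Suc j"] Cons.prems(5)[of "Suc j"] Cons.prems(6)[of "Suc j"] by simp_all
  qed (use that Cons.prems(1) in auto)
  have map_Suc: "map f [0..<length (l # w)] = f 0 # map (\<lambda>j. f (Suc j)) [0..<length w]"
    for f :: "nat \<Rightarrow> nat" using map_upt_Suc[of f "length w"] by simp
  show ?case
  proof (cases l)
    case No_Service
    have q1: "in_queue A S1 (g (Suc 0)) (c + points_in A {g 0..<g (Suc 0)})"
      "points_in ?D {g 0..<g (Suc 0)} = 0"
      using in_queue_no_service[OF A S1 g0 Cons.prems(2)] S1l No_Service by simp_all
    have q2: "in_queue ?D S2 (g (Suc 0)) d" "points_in (departures ?D S2) {g 0..<g (Suc 0)} = 0"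
      using in_queue_no_service[OF D S2 g0 Cons.prems(3)] S2l No_Service q1(2) by simp_all
    show ?thesis
      unfolding map_Suc using IH[OF q1(1) q2(1)] q2(2) No_Service by (simp add: Let_def)
  next
    case First
    then have A0: "points_in A {g 0..<g (Suc 0)} = 0" using Al by simp
    have q1: "in_queue A S1 (g (Suc 0)) (c - 1)" "points_in ?D {g 0..<g (Suc 0)} = of_bool (c > 0)"
      using in_queue_service[OF A S1 g0 Cons.prems(2) A0] S1l First by simp_all
    have q2: "in_queue ?D S2 (g (Suc 0)) (d + of_bool (c > 0))"
      "points_in (departures ?D S2) {g 0..<g (Suc 0)} = 0"
      using in_queue_no_service[OF D S2 g0 Cons.prems(3)] S2l First q1(2) by simp_all
    show ?thesis
      unfolding map_Suc using IH[OF q1(1) q2(1)] q2(2) First A0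
      by (cases "c = 0") (simp_all add: Let_def)
  next
    case Second
    then have A0: "points_in A {g 0..<g (Suc 0)} = 0" using Al by simp
    have q1: "in_queue A S1 (g (Suc 0)) c" "points_in ?D {g 0..<g (Suc 0)} = 0"
      using in_queue_no_service[OF A S1 g0 Cons.prems(2)] S1l Second A0 by simp_all
    have q2: "in_queue ?D S2 (g (Suc 0)) (d - 1)"
      "points_in (departures ?D S2) {g 0..<g (Suc 0)} = of_bool (d > 0)"
      using in_queue_service[OF D S2 g0 Cons.prems(3) q1(2)] S2l Second by simp_all
    show ?thesis
      unfolding map_Suc using IH[OF q1(1) q2(1)] q2(2) Second A0
      by (cases "d = 0") (simp_all add: Let_def)
  qed
qed

lemma departures_eq_0_before:
  assumes "A \<in> configs" "\<And>x. x < a \<Longrightarrow> A x = 0" "t < a"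
  shows "departures A S t = 0"
proof -
  have "points_in A {s..t} = 0" for s using assms by (subst points_in_eq_0) auto
  then show ?thesis by (simp add: departures_iff)
qed

text \<open>Departures occur only in service cells, and these contain neither \<open>u\<close> nor
  \<open>v\<close>; such a cell lies inside \<open>{u..<v}\<close> as soon as its left end does. A
  cell containing \<open>u\<close> or \<open>v\<close> has no service and contributes nothing, and
  nothing departs before \<open>a\<close>.\<close>

lemma tandem_points_in:
  assumes A: "A \<in> configs" and S1: "S1 \<in> configs" and S2: "S2 \<in> configs"
    and ab: "a \<le> b" "n > 0" and A0: "\<And>x. x < a \<Longrightarrow> A x = 0" and "v \<le> b"
    and len: "length w = n"
    and c1: "\<And>j. j < n \<Longrightarrow> points_in S1 (cell a b n j) = of_bool (w ! j = First)"
    and c2: "\<And>j. j < n \<Longrightarrow> points_in S2 (cell a b n j) = of_bool (w ! j = Second)"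
    and special: "\<And>j. j < n \<Longrightarrow> w ! j \<noteq> No_Service \<Longrightarrow>
      points_in A (cell a b n j) = 0 \<and> u \<notin> cell a b n j \<and> v \<notin> cell a b n j"
  shows "points_in (departures (departures A S1) S2) {u..<v}
    = (\<Sum>j<n. of_bool (u \<le> grid a b n j \<and> grid a b n j < v)
        * tandem w (\<lambda>j. points_in A (cell a b n j)) 0 0 ! j)"
proof -
  let ?D = "departures A S1" let ?DD = "departures ?D S2"
  have D: "?D \<in> configs" and DD: "?DD \<in> configs" by (intro departures_in_configs S1 S2)+
  have D0: "?D x = 0" if "x < a" for x using departures_eq_0_before[OF A A0 that] .
  have DD0: "?DD x = 0" if "x < a" for x using departures_eq_0_before[OF D D0 that] .
  have tandem: "tandem w (\<lambda>j. points_in A (cell a b n j)) 0 0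
      = map (\<lambda>j. points_in ?DD (cell a b n j)) [0..<length w]"
    unfolding cell_def
    by (rule tandem_counts_aux[OF A S1 S2, where g = "grid a b n"])
      (use A0 D0 c1 c2 special len ab in \<open>auto intro!: in_queue_empty A D grid_mono simp: cell_def\<close>)
  have "points_in ?DD {u..<v} = points_in ?DD (\<Union>j<n. cell a b n j \<inter> {u..<v})"
  proof -
    have "(\<Union>j<n. cell a b n j \<inter> {u..<v}) = {a..<b} \<inter> {u..<v}"
      unfolding UN_cells[OF ab, symmetric] by blast
    moreover have "{x \<in> {u..<v}. ?DD x \<noteq> 0} = {x \<in> {a..<b} \<inter> {u..<v}. ?DD x \<noteq> 0}"
      using DD0 \<open>v \<le> b\<close> by (auto simp: not_less[symmetric] simp del: neq0_conv)
    ultimately show ?thesis by (simp add: points_in_def)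
  qed
  also have "\<dots> = (\<Sum>j<n. points_in ?DD (cell a b n j \<inter> {u..<v}))"
    using disjoint_cells[OF ab(1), of n "{..<n}"]
    by (intro points_in_UN[OF DD]) (auto simp: disjoint_family_on_def intro: bounded_subset[OF bounded_cell])
  also have "\<dots> = (\<Sum>j<n. of_bool (u \<le> grid a b n j \<and> grid a b n j < v)
        * tandem w (\<lambda>j. points_in A (cell a b n j)) 0 0 ! j)"
  proof (rule sum.cong[OF refl])
    fix j assume "j \<in> {..<n}"
    then have j: "j < n" by simp
    have t: "tandem w (\<lambda>j. points_in A (cell a b n j)) 0 0 ! j = points_in ?DD (cell a b n j)"
      using j len by (simp add: tandem)
    have g: "grid a b n j \<le> grid a b n (Suc j)" using ab by (intro grid_mono) auto
    show "points_in ?DD (cell a b n j \<inter> {u..<v}) = of_bool (u \<le> grid a b n j \<and> grid a b n j < v)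
        * tandem w (\<lambda>j. points_in A (cell a b n j)) 0 0 ! j"
    proof (cases "w ! j = No_Service")
      case True
      then have "\<forall>x\<in>cell a b n j. S2 x = 0" using c2[OF j] by (simp add: points_in_eq_0[OF S2])
      then have "\<forall>x\<in>cell a b n j. ?DD x = 0" by (auto simp: departures_iff)
      then have "points_in ?DD (cell a b n j \<inter> {u..<v}) = 0" "points_in ?DD (cell a b n j) = 0"
        by (auto simp: points_in_def intro!: sum.neutral)
      then show ?thesis by (simp add: t)
    next
      case False
      then have uv: "u \<notin> cell a b n j" "v \<notin> cell a b n j" using special[OF j] by auto
      show ?thesis
      proof (cases "u \<le> grid a b n j \<and> grid a b n j < v")
        case True
        then have "cell a b n j \<inter> {u..<v} = cell a b n j" using uv(2) by (auto simp: cell_def)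
        then show ?thesis using True by (simp add: t)
      next
        case False
        then have "cell a b n j \<inter> {u..<v} = {}" using uv g by (auto simp: cell_def)
        then show ?thesis using False by simp
      qed
    qed
  qed
  finally show ?thesis .
qed

section \<open>Removing the cutoff of the arrivals\<close>

definition locally_tends :: "(nat \<Rightarrow> config) \<Rightarrow> config \<Rightarrow> bool" where
  "locally_tends F f \<longleftrightarrow> (\<forall>k x. F k x \<le> f x) \<and>
     (\<forall>s t. eventually (\<lambda>k. \<forall>x\<in>{s..t}. F k x = f x) sequentially)"

lemma points_in_cong: "(\<And>x. x \<in> B \<Longrightarrow> f x = g x) \<Longrightarrow> points_in f B = points_in g B"
  unfolding points_in_def by (rule sum.cong) auto

lemma locally_tends_points_in:
  assumes "locally_tends F f"
  shows "eventually (\<lambda>k. points_in (F k) {u..<v} = points_in f {u..<v}) sequentially"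
proof -
  have "eventually (\<lambda>k. \<forall>x\<in>{u..v}. F k x = f x) sequentially"
    using assms by (simp add: locally_tends_def)
  then show ?thesis by (rule eventually_mono) (auto intro: points_in_cong)
qed

lemma locally_tends_truncate: "locally_tends (\<lambda>k x. if - real k \<le> x then f x else 0) f"
  unfolding locally_tends_def
proof (intro conjI allI)
  fix s t :: real
  obtain k0 :: nat where "- s \<le> real k0" using real_arch_simple by blast
  then show "eventually (\<lambda>k. \<forall>x\<in>{s..t}. (if - real k \<le> x then f x else 0) = f x) sequentially"
    by (auto simp: eventually_sequentially intro!: exI[of _ k0])
qed auto

text \<open>A departure at \<open>x\<close> rests on one witness \<open>s\<close> and persists once
  the arrivals agree on \<open>{s..x}\<close>. The absence of a departure depends on the whole past,
  which no bounded window controls; there the domination \<open>F k x \<le> A x\<close> decides.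
  Since a window has finitely many services, agreement is simultaneous.\<close>

lemma locally_tends_departures:
  assumes A: "A \<in> configs" and S: "S \<in> configs" and F: "locally_tends F A"
  shows "locally_tends (\<lambda>k. departures (F k) S) (departures A S)"
  unfolding locally_tends_def
proof (intro conjI allI)
  have le: "departures (F k) S x \<le> departures A S x" for k x
    using F by (intro departures_mono[OF A]) (auto simp: locally_tends_def)
  then show "departures (F k) S x \<le> departures A S x" for k x .
  fix s t :: real
  have "eventually (\<lambda>k. departures (F k) S x = departures A S x) sequentially" for x
  proof (cases "departures A S x = 0")
    case True
    then show ?thesis using le[of _ x] by auto
  next
    case False
    then obtain s where s: "S x > 0" "s \<le> x" "points_in S {s..<x} < points_in A {s..x}"
      by (auto simp: departures_iff split: if_splits)
    have "eventually (\<lambda>k. \<forall>y\<in>{s..x}. F k y = A y) sequentially"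
      using F by (simp add: locally_tends_def)
    then show ?thesis
    proof (rule eventually_mono)
      fix k assume "\<forall>y\<in>{s..x}. F k y = A y"
      then have "points_in (F k) {s..x} = points_in A {s..x}" by (intro points_in_cong) auto
      with s show "departures (F k) S x = departures A S x" by (auto simp: departures_iff)
    qed
  qed
  then have "eventually (\<lambda>k. \<forall>x\<in>{x \<in> {s..t}. S x \<noteq> 0}. departures (F k) S x = departures A S x) sequentially"
    using finite_points[OF S, of "{s..t}"] by (intro eventually_ball_finite) auto
  then show "eventually (\<lambda>k. \<forall>x\<in>{s..t}. departures (F k) S x = departures A S x) sequentially"
  proof (rule eventually_mono)
    fix k assume *: "\<forall>x\<in>{x \<in> {s..t}. S x \<noteq> 0}. departures (F k) S x = departures A S x"
    show "\<forall>x\<in>{s..t}. departures (F k) S x = departures A S x"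
    proof
      fix x assume "x \<in> {s..t}"
      with * show "departures (F k) S x = departures A S x"
        by (cases "S x = 0") (auto simp: departures_iff)
    qed
  qed
qed

section \<open>Poisson services on a grid\<close>

lemma count_list_eq_sum: "count_list w l = (\<Sum>j<length w. of_bool (w ! j = l))"
  by (induction w) (simp_all add: sum.lessThan_Suc_shift del: sum.lessThan_Suc sum_of_bool_eq)

text \<open>These bound the probabilities that a Poisson variable with mean \<open>x\<close> is at
  least 1 and at least 2.\<close>

lemma one_minus_exp_le:
  fixes x :: real
  assumes "x \<ge> 0"
  shows "1 - exp (- x) \<le> x" "1 - (exp (- x) + x * exp (- x)) \<le> x ^ 2"
proof -
  have 1: "1 - x \<le> exp (- x)" using exp_ge_add_one_self[of "- x"] by simp
  then show "1 - exp (- x) \<le> x" by simp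
  have "(1 - x) * (1 + x) \<le> exp (- x) * (1 + x)" using 1 assms by (intro mult_right_mono) auto
  then show "1 - (exp (- x) + x * exp (- x)) \<le> x ^ 2" by (simp add: algebra_simps power2_eq_square)
qed

context prob_space
begin

lemma poisson_counts_measurable:
  assumes "poisson_process M \<mu> S" "B \<in> bounded_borel"
  shows "(\<lambda>\<omega>. points_in (S \<omega>) B) \<in> M \<rightarrow>\<^sub>M count_space UNIV"
  using assms by (auto simp: poisson_process_def intro: measurable_compose[OF _ measurable_points_in])

lemma poisson_cell:
  assumes "poisson_process M \<mu> S" "a \<le> b"
  shows "prob {\<omega> \<in> space M. points_in (S \<omega>) (cell a b n j) = k}
    = (\<mu> * ((b - a) / real n)) ^ k / fact k * exp (- (\<mu> * ((b - a) / real n)))"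
proof -
  have "measure lborel (cell a b n j) = (b - a) / real n"
    using assms(2) by (simp add: cell_def grid_Suc)
  then show ?thesis using assms(1) by (simp add: poisson_process_def)
qed

lemma poisson_cells:
  assumes S: "poisson_process M \<mu> S" and "a \<le> b" "n > 0"
  shows "prob {\<omega> \<in> space M. \<forall>j<n. points_in (S \<omega>) (cell a b n j) = x j}
    = (\<Prod>j<n. prob {\<omega> \<in> space M. points_in (S \<omega>) (cell a b n j) = x j})"
proof -
  have "indep_vars (\<lambda>_. count_space UNIV) (\<lambda>j \<omega>. points_in (S \<omega>) (cell a b n j)) {..<n}"
    using S disjoint_cells[OF \<open>a \<le> b\<close>, of n "{..<n}"]
    unfolding poisson_process_def by (auto simp: image_subset_iff)
  from indep_varsD_finite[OF this, of "\<lambda>j. {x j}"] \<open>n > 0\<close>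
  have "prob (\<Inter>j<n. (\<lambda>\<omega>. points_in (S \<omega>) (cell a b n j)) -` {x j} \<inter> space M)
    = (\<Prod>j<n. prob ((\<lambda>\<omega>. points_in (S \<omega>) (cell a b n j)) -` {x j} \<inter> space M))"
    by auto
  moreover have "(\<Inter>j<n. (\<lambda>\<omega>. points_in (S \<omega>) (cell a b n j)) -` {x j} \<inter> space M)
    = {\<omega> \<in> space M. \<forall>j<n. points_in (S \<omega>) (cell a b n j) = x j}"
    using \<open>n > 0\<close> by auto
  moreover have "(\<lambda>\<omega>. points_in (S \<omega>) (cell a b n j)) -` {x j} \<inter> space M
    = {\<omega> \<in> space M. points_in (S \<omega>) (cell a b n j) = x j}" for j by auto
  ultimately show ?thesis by simp
qed

text \<open>The counts 0 and 1 have factorial 1, so a cell contributes its mean when its letter is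
  \<open>l\<close>; the exponentials multiply to a factor that does not depend on the word.\<close>

lemma poisson_word:
  assumes S: "poisson_process M \<mu> S" and "a \<le> b" "n > 0" and "length w = n"
  shows "prob {\<omega> \<in> space M. \<forall>j<n. points_in (S \<omega>) (cell a b n j) = of_bool (w ! j = l)}
    = (\<mu> * ((b - a) / real n)) ^ count_list w l * exp (- (\<mu> * (b - a)))"
proof -
  let ?m = "\<mu> * ((b - a) / real n)"
  have "prob {\<omega> \<in> space M. \<forall>j<n. points_in (S \<omega>) (cell a b n j) = of_bool (w ! j = l)}
    = (\<Prod>j<n. ?m ^ of_bool (w ! j = l) * exp (- ?m))"
    unfolding poisson_cells[OF S assms(2,3)] poisson_cell[OF S assms(2)]
    by (intro prod.cong) auto
  also have "\<dots> = ?m ^ (\<Sum>j<n. of_bool (w ! j = l)) * exp (- ?m) ^ n"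
    by (simp add: prod.distrib power_sum del: sum_of_bool_eq)
  also have "exp (- ?m) ^ n = exp (- (\<mu> * (b - a)))"
    using \<open>n > 0\<close> by (simp flip: exp_of_nat_mult)
  finally show ?thesis using count_list_eq_sum[of w l] assms(4) by simp
qed

lemma poisson_cell_ge:
  assumes S: "poisson_process M \<mu> S" and "\<mu> > 0" "a \<le> b"
  shows "prob {\<omega> \<in> space M. points_in (S \<omega>) (cell a b n j) \<ge> 1} \<le> \<mu> * ((b - a) / real n)"
    and "prob {\<omega> \<in> space M. points_in (S \<omega>) (cell a b n j) \<ge> 2} \<le> (\<mu> * ((b - a) / real n)) ^ 2"
proof -
  let ?m = "\<mu> * ((b - a) / real n)"
  let ?X = "\<lambda>\<omega>. points_in (S \<omega>) (cell a b n j)"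
  have m: "?m \<ge> 0" using assms by simp
  have [measurable]: "?X \<in> M \<rightarrow>\<^sub>M count_space UNIV"
    by (rule poisson_counts_measurable[OF S]) simp
  have "prob {\<omega> \<in> space M. ?X \<omega> \<ge> 1} = prob {\<omega> \<in> space M. \<not> ?X \<omega> = 0}"
    by (intro arg_cong[where f = prob]) auto
  also have "\<dots> = 1 - exp (- ?m)"
    by (subst prob_neg) (simp_all add: poisson_cell[OF S assms(3)])
  also have "\<dots> \<le> ?m" by (rule one_minus_exp_le(1)[OF m])
  finally show "prob {\<omega> \<in> space M. ?X \<omega> \<ge> 1} \<le> ?m" .
  have "prob {\<omega> \<in> space M. ?X \<omega> = 0 \<or> ?X \<omega> = 1}
      = prob ({\<omega> \<in> space M. ?X \<omega> = 0} \<union> {\<omega> \<in> space M. ?X \<omega> = 1})"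
    by (intro arg_cong[where f = prob]) auto
  also have "\<dots> = exp (- ?m) + ?m * exp (- ?m)"
    by (subst finite_measure_Union) (auto simp: poisson_cell[OF S assms(3)])
  finally have 01: "prob {\<omega> \<in> space M. ?X \<omega> = 0 \<or> ?X \<omega> = 1} = exp (- ?m) + ?m * exp (- ?m)" .
  have "prob {\<omega> \<in> space M. ?X \<omega> \<ge> 2} = prob {\<omega> \<in> space M. \<not> (?X \<omega> = 0 \<or> ?X \<omega> = 1)}"
    by (intro arg_cong[where f = prob]) auto
  also have "\<dots> = 1 - (exp (- ?m) + ?m * exp (- ?m))"
    by (subst prob_neg) (simp_all add: 01[simplified])
  also have "\<dots> \<le> ?m ^ 2" by (rule one_minus_exp_le(2)[OF m])
  finally show "prob {\<omega> \<in> space M. ?X \<omega> \<ge> 2} \<le> ?m ^ 2" .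
qed

lemma prob_tendsto_eventually:
  assumes [measurable]: "\<And>k. E k \<in> events" "F \<in> events"
    and ev: "\<And>\<omega>. \<omega> \<in> space M \<Longrightarrow> eventually (\<lambda>k::nat. \<omega> \<in> E k \<longleftrightarrow> \<omega> \<in> F) sequentially"
  shows "(\<lambda>k. prob (E k)) \<longlonglongrightarrow> prob F"
proof -
  have "(\<lambda>k. integral\<^sup>L M (indicator (E k) :: 'a \<Rightarrow> real)) \<longlonglongrightarrow> integral\<^sup>L M (indicator F)"
  proof (rule integral_dominated_convergence[where w = "\<lambda>_. 1"])
    have "(\<lambda>k. indicator (E k) \<omega> :: real) \<longlonglongrightarrow> indicator F \<omega>" if "\<omega> \<in> space M" for \<omega>
      using ev[OF that] by (intro tendsto_eventually) (auto simp: indicator_def elim: eventually_mono)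
    then show "AE \<omega> in M. (\<lambda>k. indicator (E k) \<omega> :: real) \<longlonglongrightarrow> indicator F \<omega>" by simp
  qed (auto simp: indicator_def)
  then show ?thesis by simp
qed

end

text \<open>The words that describe a window of the two service processes when every cell holds at most one
  service and the cells that meet \<open>P\<close> hold none.\<close>

definition words ::
  "real \<Rightarrow> real \<Rightarrow> nat \<Rightarrow> real set \<Rightarrow> 'i set \<Rightarrow> ('i \<Rightarrow> config) \<Rightarrow> ('i \<Rightarrow> real) \<Rightarrow> ('i \<Rightarrow> real)
    \<Rightarrow> (('i \<Rightarrow> nat) \<Rightarrow> bool) \<Rightarrow> letter list set" where
  "words a b n P I \<alpha> u v C = {w. length w = n
    \<and> (\<forall>j<n. w ! j \<noteq> No_Service \<longrightarrow> P \<inter> cell a b n j = {})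
    \<and> C (\<lambda>i\<in>I. \<Sum>j<n. of_bool (u i \<le> grid a b n j \<and> grid a b n j < v i)
        * tandem w (\<lambda>j. points_in (\<alpha> i) (cell a b n j)) 0 0 ! j)}"

lemma finite_words: "finite (words a b n P I \<alpha> u v C)"
proof (rule finite_subset)
  show "words a b n P I \<alpha> u v C \<subseteq> {w. set w \<subseteq> {No_Service, First, Second} \<and> length w = n}"
    unfolding words_def using letter.exhaust by blast
qed (simp add: finite_lists_length_eq)

text \<open>Length, places of \<open>No_Service\<close> and output are invariant under a flip, and
  \<open>words\<close> constrains a word only through them. One flip serves all
  \<open>i \<in> I\<close>, because \<open>flip_tandem\<close> holds for every arrival
  sequence.\<close>

lemma flip_words:
  assumes "flip w w'" shows "w \<in> words a b n P I \<alpha> u v C \<longleftrightarrow> w' \<in> words a b n P I \<alpha> u v C"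
  by (simp add: words_def flip_length[OF assms] flip_tandem[OF assms] flip_nth_No_Service[OF assms])

definition sparse :: "real \<Rightarrow> real \<Rightarrow> nat \<Rightarrow> real set \<Rightarrow> config \<Rightarrow> config \<Rightarrow> bool" where
  "sparse a b n P S1 S2 \<longleftrightarrow> (\<forall>j<n. points_in S1 (cell a b n j) + points_in S2 (cell a b n j) \<le> 1
    \<and> (P \<inter> cell a b n j \<noteq> {} \<longrightarrow> points_in S1 (cell a b n j) + points_in S2 (cell a b n j) = 0))"

lemma sparse_commute: "sparse a b n P S1 S2 = sparse a b n P S2 S1"
  by (simp add: sparse_def add.commute)

text \<open>The index set allows several arrival configurations, one per cumulative class, to be
  tested on several intervals against the same pair of services.\<close>

definition out_counts ::
  "'i set \<Rightarrow> ('i \<Rightarrow> config) \<Rightarrow> ('i \<Rightarrow> real) \<Rightarrow> ('i \<Rightarrow> real) \<Rightarrow> config \<Rightarrow> config \<Rightarrow> 'i \<Rightarrow> nat" where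
  "out_counts I \<alpha> u v S1 S2 = (\<lambda>i\<in>I. points_in (departures (departures (\<alpha> i) S1) S2) {u i..<v i})"

section \<open>Two independent Poisson services read as a random word\<close>

locale poisson_pair = prob_space +
  fixes \<mu>1 \<mu>2 :: real and S1 S2 :: "'a \<Rightarrow> config"
  assumes rate_pos: "\<mu>1 > 0" "\<mu>2 > 0"
    and poisson1: "poisson_process M \<mu>1 S1" and poisson2: "poisson_process M \<mu>2 S2"
    and indep: "indep_elements M config_space S1 config_space S2"
begin

lemma measurable_S [measurable]: "S1 \<in> M \<rightarrow>\<^sub>M config_space" "S2 \<in> M \<rightarrow>\<^sub>M config_space"
  using poisson1 poisson2 by (auto simp: poisson_process_def)

lemma S_configs: "\<omega> \<in> space M \<Longrightarrow> S1 \<omega> \<in> configs" "\<omega> \<in> space M \<Longrightarrow> S2 \<omega> \<in> configs"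
  using measurable_space[OF measurable_S(1)] measurable_space[OF measurable_S(2)] by simp_all

lemma measurable_counts [measurable]:
  "(\<lambda>\<omega>. points_in (S1 \<omega>) (cell a b n j)) \<in> M \<rightarrow>\<^sub>M count_space UNIV"
  "(\<lambda>\<omega>. points_in (S2 \<omega>) (cell a b n j)) \<in> M \<rightarrow>\<^sub>M count_space UNIV"
  using poisson_counts_measurable[OF poisson1] poisson_counts_measurable[OF poisson2] by simp_all

lemma prob_indep:
  assumes "Measurable.pred config_space Q1" "Measurable.pred config_space Q2"
  shows "prob {\<omega> \<in> space M. Q1 (S1 \<omega>) \<and> Q2 (S2 \<omega>)}
    = prob {\<omega> \<in> space M. Q1 (S1 \<omega>)} * prob {\<omega> \<in> space M. Q2 (S2 \<omega>)}"
proof -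
  let ?E = "{s \<in> space config_space. Q1 s}" and ?F = "{s \<in> space config_space. Q2 s}"
  have EF: "?E \<in> sets config_space" "?F \<in> sets config_space" using assms by measurable
  have "prob ((S1 -` ?E \<inter> space M) \<inter> (S2 -` ?F \<inter> space M))
    = prob (S1 -` ?E \<inter> space M) * prob (S2 -` ?F \<inter> space M)"
  proof (rule indep_setD)
    show "indep_set {S1 -` E \<inter> space M |E. E \<in> sets config_space}
        {S2 -` F \<inter> space M |F. F \<in> sets config_space}"
      using indep by (simp add: indep_elements_def)
  qed (use EF in blast)+
  moreover have "S1 -` ?E \<inter> space M = {\<omega> \<in> space M. Q1 (S1 \<omega>)}"
    "S2 -` ?F \<inter> space M = {\<omega> \<in> space M. Q2 (S2 \<omega>)}"
    using S_configs by auto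
  moreover have "{\<omega> \<in> space M. Q1 (S1 \<omega>)} \<inter> {\<omega> \<in> space M. Q2 (S2 \<omega>)}
    = {\<omega> \<in> space M. Q1 (S1 \<omega>) \<and> Q2 (S2 \<omega>)}" by auto
  ultimately show ?thesis by simp
qed

text \<open>This makes every result of the locale available for the servers in the opposite
  order.\<close>

lemma pair_swap: "poisson_pair M \<mu>2 \<mu>1 S2 S1"
proof unfold_locales
  have 1: "indep_set {S1 -` E \<inter> space M |E. E \<in> sets config_space} {S2 -` F \<inter> space M |F. F \<in> sets config_space}"
    using indep by (simp add: indep_elements_def)
  have "indep_set {S2 -` F \<inter> space M |F. F \<in> sets config_space} {S1 -` E \<inter> space M |E. E \<in> sets config_space}"
  proof (rule indep_setI[OF indep_setD_ev2[OF 1] indep_setD_ev1[OF 1]])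
    fix E F assume "E \<in> {S2 -` F \<inter> space M |F. F \<in> sets config_space}"
      "F \<in> {S1 -` E \<inter> space M |E. E \<in> sets config_space}"
    then show "prob (E \<inter> F) = prob E * prob F"
      using indep_setD[OF 1, of F E] by (simp only: Int_commute mult.commute)
  qed
  then show "indep_elements M config_space S2 config_space S1"
    by (simp add: indep_elements_def)
qed (use rate_pos poisson1 poisson2 in auto)

definition atom :: "real \<Rightarrow> real \<Rightarrow> nat \<Rightarrow> letter list \<Rightarrow> 'a set" where
  "atom a b n w = {\<omega> \<in> space M. (\<forall>j<n. points_in (S1 \<omega>) (cell a b n j) = of_bool (w ! j = First))
      \<and> (\<forall>j<n. points_in (S2 \<omega>) (cell a b n j) = of_bool (w ! j = Second))}"

lemma atom_events: "atom a b n w \<in> events"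
  unfolding atom_def by measurable

lemma atom_counts:
  assumes "\<omega> \<in> atom a b n w" "j < n"
  shows "points_in (S1 \<omega>) (cell a b n j) = of_bool (w ! j = First)"
    "points_in (S2 \<omega>) (cell a b n j) = of_bool (w ! j = Second)"
  using assms by (simp_all add: atom_def)

text \<open>The exponential is symmetric in the two rates and common to all words, which leaves the
  polynomial weights to \<open>sum_words_swap\<close>.\<close>

lemma prob_atom:
  assumes "a \<le> b" "n > 0" "length w = n"
  shows "prob (atom a b n w) = (\<mu>1 * ((b - a) / real n)) ^ count_list w First
    * (\<mu>2 * ((b - a) / real n)) ^ count_list w Second * exp (- ((\<mu>1 + \<mu>2) * (b - a)))"
proof -
  have [measurable]: "(\<lambda>s. points_in s (cell a b n j)) \<in> config_space \<rightarrow>\<^sub>M count_space UNIV" for j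
    by (rule measurable_points_in) simp
  have "prob (atom a b n w)
    = prob {\<omega> \<in> space M. \<forall>j<n. points_in (S1 \<omega>) (cell a b n j) = of_bool (w ! j = First)}
    * prob {\<omega> \<in> space M. \<forall>j<n. points_in (S2 \<omega>) (cell a b n j) = of_bool (w ! j = Second)}"
    unfolding atom_def by (rule prob_indep) measurable
  also have "\<dots> = (\<mu>1 * ((b - a) / real n)) ^ count_list w First * exp (- (\<mu>1 * (b - a)))
    * ((\<mu>2 * ((b - a) / real n)) ^ count_list w Second * exp (- (\<mu>2 * (b - a))))"
    by (simp only: poisson_word[OF poisson1 assms] poisson_word[OF poisson2 assms])
  finally have "prob (atom a b n w)
    = (\<mu>1 * ((b - a) / real n)) ^ count_list w First * exp (- (\<mu>1 * (b - a)))
    * ((\<mu>2 * ((b - a) / real n)) ^ count_list w Second * exp (- (\<mu>2 * (b - a))))" .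
  moreover have "exp (- ((\<mu>1 + \<mu>2) * (b - a))) = exp (- (\<mu>1 * (b - a))) * exp (- (\<mu>2 * (b - a)))"
    by (simp add: algebra_simps flip: exp_add)
  ultimately show ?thesis by (simp add: mult_ac)
qed

text \<open>On a sparse window the services spell exactly one word, and this word determines
  \<open>out_counts\<close>. The event is therefore the disjoint union of the atoms of the
  admissible words.\<close>

lemma prob_sparse_out_counts:
  assumes ab: "a \<le> b" "n > 0"
    and \<alpha>: "\<And>i. i \<in> I \<Longrightarrow> \<alpha> i \<in> configs" "\<And>i x. i \<in> I \<Longrightarrow> x < a \<Longrightarrow> \<alpha> i x = 0"
    and v: "\<And>i. i \<in> I \<Longrightarrow> v i \<le> b"
    and P: "\<And>i. i \<in> I \<Longrightarrow> u i \<in> P \<and> v i \<in> P"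
      "\<And>i x. i \<in> I \<Longrightarrow> a \<le> x \<Longrightarrow> x < b \<Longrightarrow> \<alpha> i x \<noteq> 0 \<Longrightarrow> x \<in> P"
  shows "prob {\<omega> \<in> space M. sparse a b n P (S1 \<omega>) (S2 \<omega>) \<and> C (out_counts I \<alpha> u v (S1 \<omega>) (S2 \<omega>))}
    = exp (- ((\<mu>1 + \<mu>2) * (b - a))) * (\<Sum>w\<in>words a b n P I \<alpha> u v C.
        (\<mu>1 * ((b - a) / real n)) ^ count_list w First * (\<mu>2 * ((b - a) / real n)) ^ count_list w Second)"
proof -
  have cell_ab: "cell a b n j \<subseteq> {a..<b}" if "j < n" for j using UN_cells[OF ab] that by blast
  have out: "out_counts I \<alpha> u v (S1 \<omega>) (S2 \<omega>)
      = (\<lambda>i\<in>I. \<Sum>j<n. of_bool (u i \<le> grid a b n j \<and> grid a b n j < v i)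
        * tandem w (\<lambda>j. points_in (\<alpha> i) (cell a b n j)) 0 0 ! j)"
    if \<omega>: "\<omega> \<in> atom a b n w" and w: "length w = n" "\<forall>j<n. w ! j \<noteq> No_Service \<longrightarrow> P \<inter> cell a b n j = {}"
    for \<omega> w
    unfolding out_counts_def
  proof (rule restrict_ext)
    fix i assume i: "i \<in> I"
    have S: "S1 \<omega> \<in> configs" "S2 \<omega> \<in> configs" using \<omega> S_configs by (auto simp: atom_def)
    show "points_in (departures (departures (\<alpha> i) (S1 \<omega>)) (S2 \<omega>)) {u i..<v i}
      = (\<Sum>j<n. of_bool (u i \<le> grid a b n j \<and> grid a b n j < v i)
        * tandem w (\<lambda>j. points_in (\<alpha> i) (cell a b n j)) 0 0 ! j)"
    proof (rule tandem_points_in[OF \<alpha>(1)[OF i] S ab \<alpha>(2)[OF i] v[OF i] w(1)])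
      fix j assume j: "j < n"
      show "points_in (S1 \<omega>) (cell a b n j) = of_bool (w ! j = First)"
        "points_in (S2 \<omega>) (cell a b n j) = of_bool (w ! j = Second)"
        using \<omega> j by (auto simp: atom_def)
      assume "w ! j \<noteq> No_Service"
      with w(2) j have Pj: "P \<inter> cell a b n j = {}" by blast
      then have "\<forall>x\<in>cell a b n j. \<alpha> i x = 0"
        using P(2)[OF i] cell_ab[OF j] by (meson atLeastLessThan_iff disjoint_iff subsetD)
      then show "points_in (\<alpha> i) (cell a b n j) = 0 \<and> u i \<notin> cell a b n j \<and> v i \<notin> cell a b n j"
        using Pj P(1)[OF i] by (auto simp: points_in_eq_0[OF \<alpha>(1)[OF i]])
    qed
  qed
  have "{\<omega> \<in> space M. sparse a b n P (S1 \<omega>) (S2 \<omega>) \<and> C (out_counts I \<alpha> u v (S1 \<omega>) (S2 \<omega>))}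
    = (\<Union>w\<in>words a b n P I \<alpha> u v C. atom a b n w)"
  proof (intro equalityI subsetI)
    fix \<omega> assume "\<omega> \<in> {\<omega> \<in> space M. sparse a b n P (S1 \<omega>) (S2 \<omega>) \<and> C (out_counts I \<alpha> u v (S1 \<omega>) (S2 \<omega>))}"
    then have \<omega>: "\<omega> \<in> space M" "sparse a b n P (S1 \<omega>) (S2 \<omega>)" "C (out_counts I \<alpha> u v (S1 \<omega>) (S2 \<omega>))" by auto
    define w where "w = map (\<lambda>j. if points_in (S1 \<omega>) (cell a b n j) = 1 then First
      else if points_in (S2 \<omega>) (cell a b n j) = 1 then Second else No_Service) [0..<n]"
    have w: "w ! j = (if points_in (S1 \<omega>) (cell a b n j) = 1 then First
      else if points_in (S2 \<omega>) (cell a b n j) = 1 then Second else No_Service)" if "j < n" for j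
      using that by (simp add: w_def)
    have le: "points_in (S1 \<omega>) (cell a b n j) + points_in (S2 \<omega>) (cell a b n j) \<le> 1"
      "P \<inter> cell a b n j \<noteq> {} \<Longrightarrow> points_in (S1 \<omega>) (cell a b n j) + points_in (S2 \<omega>) (cell a b n j) = 0"
      if "j < n" for j
      using \<omega>(2) that by (auto simp: sparse_def)
    have "points_in (S1 \<omega>) (cell a b n j) = of_bool (w ! j = First)"
      "points_in (S2 \<omega>) (cell a b n j) = of_bool (w ! j = Second)" if "j < n" for j
      unfolding w[OF that] using le(1)[OF that] by (auto simp: le_Suc_eq)
    then have atom: "\<omega> \<in> atom a b n w" using \<omega>(1) by (simp add: atom_def)
    have "length w = n" by (simp add: w_def)
    moreover have "\<forall>j<n. w ! j \<noteq> No_Service \<longrightarrow> P \<inter> cell a b n j = {}"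
      using w le(2) by (fastforce split: if_splits)
    ultimately have "w \<in> words a b n P I \<alpha> u v C"
      using out[OF atom] \<omega>(3) by (simp add: words_def)
    with atom show "\<omega> \<in> (\<Union>w\<in>words a b n P I \<alpha> u v C. atom a b n w)" by blast
  next
    fix \<omega> assume "\<omega> \<in> (\<Union>w\<in>words a b n P I \<alpha> u v C. atom a b n w)"
    then obtain w where w: "w \<in> words a b n P I \<alpha> u v C" "\<omega> \<in> atom a b n w" by blast
    have "sparse a b n P (S1 \<omega>) (S2 \<omega>)"
      unfolding sparse_def
    proof (intro allI impI conjI)
      fix j assume "j < n"
      then have *: "points_in (S1 \<omega>) (cell a b n j) = of_bool (w ! j = First)"
        "points_in (S2 \<omega>) (cell a b n j) = of_bool (w ! j = Second)"
        "w ! j \<noteq> No_Service \<longrightarrow> P \<inter> cell a b n j = {}"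
        using w by (auto simp: atom_def words_def)
      show "points_in (S1 \<omega>) (cell a b n j) + points_in (S2 \<omega>) (cell a b n j) \<le> 1"
        using * by (cases "w ! j") auto
      assume "P \<inter> cell a b n j \<noteq> {}"
      then show "points_in (S1 \<omega>) (cell a b n j) + points_in (S2 \<omega>) (cell a b n j) = 0"
        using * by (cases "w ! j") auto
    qed
    moreover have "C (out_counts I \<alpha> u v (S1 \<omega>) (S2 \<omega>))"
      using out[OF w(2)] w(1) by (simp add: words_def)
    ultimately show "\<omega> \<in> {\<omega> \<in> space M. sparse a b n P (S1 \<omega>) (S2 \<omega>) \<and> C (out_counts I \<alpha> u v (S1 \<omega>) (S2 \<omega>))}"
      using w(2) by (simp add: atom_def)
  qed
  also have "prob \<dots> = (\<Sum>w\<in>words a b n P I \<alpha> u v C. prob (atom a b n w))"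
  proof (rule finite_measure_finite_Union)
    show "disjoint_family_on (atom a b n) (words a b n P I \<alpha> u v C)"
      unfolding disjoint_family_on_def
    proof (intro ballI impI equals0I)
      fix w w' \<omega> assume w: "w \<in> words a b n P I \<alpha> u v C" "w' \<in> words a b n P I \<alpha> u v C" "w \<noteq> w'"
        and \<omega>: "\<omega> \<in> atom a b n w \<inter> atom a b n w'"
      \<comment> \<open>The two service counts of a cell determine its letter.\<close>
      have "w ! j = w' ! j" if "j < n" for j
      proof -
        have "points_in (S1 \<omega>) (cell a b n j) = of_bool (w ! j = First)"
          "points_in (S1 \<omega>) (cell a b n j) = of_bool (w' ! j = First)"
          "points_in (S2 \<omega>) (cell a b n j) = of_bool (w ! j = Second)"
          "points_in (S2 \<omega>) (cell a b n j) = of_bool (w' ! j = Second)"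
          using \<omega> atom_counts[OF _ that] by blast+
        then show ?thesis by (cases "w ! j"; cases "w' ! j") simp_all
      qed
      then have "w = w'" using w(1,2) by (intro nth_equalityI) (auto simp: words_def)
      with w(3) show False by simp
    qed
  qed (use finite_words atom_events in auto)
  also have "\<dots> = (\<Sum>w\<in>words a b n P I \<alpha> u v C. (\<mu>1 * ((b - a) / real n)) ^ count_list w First
    * (\<mu>2 * ((b - a) / real n)) ^ count_list w Second * exp (- ((\<mu>1 + \<mu>2) * (b - a))))"
    using ab by (intro sum.cong) (auto simp: prob_atom words_def)
  finally show ?thesis by (simp add: sum_distrib_left mult_ac)
qed

text \<open>A union bound: two services share a cell with probability of order
  \<open>1 / n^2\<close>, in each of \<open>n\<close> cells; a service in a cell meeting
  \<open>P\<close> has probability of order \<open>1 / n\<close>, but at most \<open>card P\<close>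
  cells meet \<open>P\<close>.\<close>

lemma prob_not_sparse:
  assumes ab: "a \<le> b" "n > 0" and P: "finite P"
  shows "prob {\<omega> \<in> space M. \<not> sparse a b n P (S1 \<omega>) (S2 \<omega>)}
    \<le> ((b - a)\<^sup>2 * (\<mu>1\<^sup>2 + \<mu>2\<^sup>2 + \<mu>1 * \<mu>2) + real (card P) * (b - a) * (\<mu>1 + \<mu>2)) / real n"
proof -
  define m1 m2 where "m1 = \<mu>1 * ((b - a) / real n)" and "m2 = \<mu>2 * ((b - a) / real n)"
  define X Y where "X \<omega> j = points_in (S1 \<omega>) (cell a b n j)"
    and "Y \<omega> j = points_in (S2 \<omega>) (cell a b n j)" for \<omega> j
  have [measurable]: "(\<lambda>\<omega>. X \<omega> j) \<in> M \<rightarrow>\<^sub>M count_space UNIV" "(\<lambda>\<omega>. Y \<omega> j) \<in> M \<rightarrow>\<^sub>M count_space UNIV" for j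
    unfolding X_def Y_def by measurable
  define E where "E j = ({\<omega> \<in> space M. X \<omega> j \<ge> 2} \<union> {\<omega> \<in> space M. Y \<omega> j \<ge> 2})
    \<union> {\<omega> \<in> space M. X \<omega> j \<ge> 1 \<and> Y \<omega> j \<ge> 1}" for j
  define F where "F j = {\<omega> \<in> space M. X \<omega> j \<ge> 1} \<union> {\<omega> \<in> space M. Y \<omega> j \<ge> 1}" for j
  define J where "J = {j \<in> {..<n}. P \<inter> cell a b n j \<noteq> {}}"
  have [measurable]: "E j \<in> events" "F j \<in> events" for j unfolding E_def F_def by measurable
  have [measurable]: "(\<lambda>s. points_in s (cell a b n j)) \<in> config_space \<rightarrow>\<^sub>M count_space UNIV" for j
    by (rule measurable_points_in) simp
  have X: "prob {\<omega> \<in> space M. X \<omega> j \<ge> 1} \<le> m1" "prob {\<omega> \<in> space M. X \<omega> j \<ge> 2} \<le> m1\<^sup>2"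
    and Y: "prob {\<omega> \<in> space M. Y \<omega> j \<ge> 1} \<le> m2" "prob {\<omega> \<in> space M. Y \<omega> j \<ge> 2} \<le> m2\<^sup>2" for j
    unfolding X_def Y_def m1_def m2_def
    using poisson_cell_ge[OF poisson1 rate_pos(1) ab(1)] poisson_cell_ge[OF poisson2 rate_pos(2) ab(1)]
    by simp_all
  have XY: "prob {\<omega> \<in> space M. X \<omega> j \<ge> 1 \<and> Y \<omega> j \<ge> 1} \<le> m1 * m2" for j
  proof -
    have "prob {\<omega> \<in> space M. X \<omega> j \<ge> 1 \<and> Y \<omega> j \<ge> 1}
      = prob {\<omega> \<in> space M. X \<omega> j \<ge> 1} * prob {\<omega> \<in> space M. Y \<omega> j \<ge> 1}"
      unfolding X_def Y_def by (rule prob_indep) measurable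
    also have "\<dots> \<le> m1 * m2"
      using X(1)[of j] Y(1)[of j] order_trans[OF measure_nonneg X(1)] by (intro mult_mono) auto
    finally show ?thesis .
  qed
  have E: "prob (E j) \<le> m1\<^sup>2 + m2\<^sup>2 + m1 * m2" for j
  proof -
    have "prob (E j) \<le> prob ({\<omega> \<in> space M. X \<omega> j \<ge> 2} \<union> {\<omega> \<in> space M. Y \<omega> j \<ge> 2})
      + prob {\<omega> \<in> space M. X \<omega> j \<ge> 1 \<and> Y \<omega> j \<ge> 1}"
      unfolding E_def by (rule measure_Un_le) auto
    also have "prob ({\<omega> \<in> space M. X \<omega> j \<ge> 2} \<union> {\<omega> \<in> space M. Y \<omega> j \<ge> 2})
      \<le> prob {\<omega> \<in> space M. X \<omega> j \<ge> 2} + prob {\<omega> \<in> space M. Y \<omega> j \<ge> 2}"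
      by (rule measure_Un_le) auto
    finally show ?thesis using X(2)[of j] Y(2)[of j] XY[of j] by linarith
  qed
  have F: "prob (F j) \<le> m1 + m2" for j
  proof -
    have "prob (F j) \<le> prob {\<omega> \<in> space M. X \<omega> j \<ge> 1} + prob {\<omega> \<in> space M. Y \<omega> j \<ge> 1}"
      unfolding F_def by (rule measure_Un_le) auto
    then show ?thesis using X(1)[of j] Y(1)[of j] by linarith
  qed
  have m0: "m1 \<ge> 0" "m2 \<ge> 0" using rate_pos ab by (simp_all add: m1_def m2_def)
  \<comment> \<open>Choosing a point of \<open>P\<close> in every such cell is injective, since
    cells are disjoint.\<close>
  have cardJ: "card J \<le> card P"
  proof -
    have "\<forall>j\<in>J. \<exists>p. p \<in> P \<and> p \<in> cell a b n j" by (auto simp: J_def)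
    then obtain p where p: "\<forall>j\<in>J. p j \<in> P \<and> p j \<in> cell a b n j" by metis
    have "inj_on p J"
    proof (rule inj_onI)
      fix i j assume ij: "i \<in> J" "j \<in> J" "p i = p j"
      then have "p i \<in> cell a b n i \<inter> cell a b n j" using p by auto
      then show "i = j"
        using disjoint_cells[OF ab(1), of n UNIV] by (auto simp: disjoint_family_on_def)
    qed
    moreover have "p ` J \<subseteq> P" using p by auto
    ultimately show ?thesis using P card_inj_on_le by blast
  qed
  have J: "finite J" by (simp add: J_def)
  have "{\<omega> \<in> space M. \<not> sparse a b n P (S1 \<omega>) (S2 \<omega>)} \<subseteq> (\<Union>j<n. E j) \<union> (\<Union>j\<in>J. F j)"
  proof
    fix \<omega> assume "\<omega> \<in> {\<omega> \<in> space M. \<not> sparse a b n P (S1 \<omega>) (S2 \<omega>)}"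
    then obtain j where \<omega>: "\<omega> \<in> space M" and j: "j < n"
      "\<not> (X \<omega> j + Y \<omega> j \<le> 1 \<and> (P \<inter> cell a b n j \<noteq> {} \<longrightarrow> X \<omega> j + Y \<omega> j = 0))"
      unfolding sparse_def X_def Y_def by blast
    show "\<omega> \<in> (\<Union>j<n. E j) \<union> (\<Union>j\<in>J. F j)"
    proof (cases "X \<omega> j + Y \<omega> j \<le> 1")
      case True
      with j have "j \<in> J" "X \<omega> j \<ge> 1 \<or> Y \<omega> j \<ge> 1" by (auto simp: J_def)
      with \<omega> show ?thesis by (auto simp: F_def)
    next
      case False
      then have "X \<omega> j \<ge> 2 \<or> Y \<omega> j \<ge> 2 \<or> X \<omega> j \<ge> 1 \<and> Y \<omega> j \<ge> 1" by arith
      with \<omega> have "\<omega> \<in> E j" by (auto simp: E_def)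
      with j show ?thesis by blast
    qed
  qed
  then have "prob {\<omega> \<in> space M. \<not> sparse a b n P (S1 \<omega>) (S2 \<omega>)} \<le> prob ((\<Union>j<n. E j) \<union> (\<Union>j\<in>J. F j))"
    using J by (intro finite_measure_mono) (auto intro!: sets.Un sets.finite_UN)
  also have "\<dots> \<le> prob (\<Union>j<n. E j) + prob (\<Union>j\<in>J. F j)"
    using J by (intro measure_Un_le) (auto intro!: sets.finite_UN)
  also have "prob (\<Union>j<n. E j) \<le> (\<Sum>j<n. prob (E j))"
    by (intro finite_measure_subadditive_finite) auto
  also have "\<dots> \<le> (\<Sum>j<n. m1\<^sup>2 + m2\<^sup>2 + m1 * m2)" by (intro sum_mono E)
  also have "prob (\<Union>j\<in>J. F j) \<le> (\<Sum>j\<in>J. prob (F j))"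
    using J by (intro finite_measure_subadditive_finite) auto
  also have "\<dots> \<le> (\<Sum>j\<in>J. m1 + m2)" by (intro sum_mono F)
  also have "\<dots> \<le> real (card P) * (m1 + m2)"
    using cardJ m0 by (simp add: mult_right_mono)
  finally have "prob {\<omega> \<in> space M. \<not> sparse a b n P (S1 \<omega>) (S2 \<omega>)}
    \<le> real n * (m1\<^sup>2 + m2\<^sup>2 + m1 * m2) + real (card P) * (m1 + m2)" by simp
  also have "\<dots> = ((b - a)\<^sup>2 * (\<mu>1\<^sup>2 + \<mu>2\<^sup>2 + \<mu>1 * \<mu>2) + real (card P) * (b - a) * (\<mu>1 + \<mu>2)) / real n"
  proof -
    have "real n * (m1\<^sup>2 + m2\<^sup>2 + m1 * m2) = (b - a)\<^sup>2 * (\<mu>1\<^sup>2 + \<mu>2\<^sup>2 + \<mu>1 * \<mu>2) / real n"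
      using ab(2) by (simp add: m1_def m2_def power2_eq_square divide_simps) (simp add: algebra_simps)
    moreover have "real (card P) * (m1 + m2) = real (card P) * (b - a) * (\<mu>1 + \<mu>2) / real n"
      by (simp add: m1_def m2_def algebra_simps add_divide_distrib diff_divide_distrib)
    ultimately show ?thesis by (simp add: add_divide_distrib)
  qed
  finally show ?thesis .
qed

end

section \<open>Interchanging the two servers\<close>

text \<open>Finitely many natural numbers form a countable discrete space, so every condition
  \<open>C\<close> on the counts is measurable.\<close>

lemma out_counts_measurable:
  assumes X: "X \<in> N \<rightarrow>\<^sub>M config_space" and Y: "Y \<in> N \<rightarrow>\<^sub>M config_space"
    and I: "finite I" and \<alpha>: "\<And>i. i \<in> I \<Longrightarrow> \<alpha> i \<in> configs"
  shows "Measurable.pred N (\<lambda>\<omega>. C (out_counts I \<alpha> u v (X \<omega>) (Y \<omega>)))"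
proof -
  have "(\<lambda>\<omega>. points_in (departures (departures (\<alpha> i) (X \<omega>)) (Y \<omega>)) {u i..<v i}) \<in> N \<rightarrow>\<^sub>M count_space UNIV"
    if "i \<in> I" for i
  proof -
    have "(\<lambda>\<omega>. \<alpha> i) \<in> N \<rightarrow>\<^sub>M config_space" using \<alpha>[OF that] by simp
    then show ?thesis
      by (intro measurable_compose[OF _ measurable_points_in] measurable_departures X Y) auto
  qed
  then have "(\<lambda>\<omega>. out_counts I \<alpha> u v (X \<omega>) (Y \<omega>)) \<in> N \<rightarrow>\<^sub>M PiM I (\<lambda>_. count_space UNIV)"
    unfolding out_counts_def by (rule measurable_restrict)
  then have "(\<lambda>\<omega>. out_counts I \<alpha> u v (X \<omega>) (Y \<omega>)) \<in> N \<rightarrow>\<^sub>M count_space (PiE I (\<lambda>_. UNIV))"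
    by (simp add: count_space_PiM_finite[OF I])
  then show ?thesis by (rule measurable_compose) simp
qed

context poisson_pair
begin

text \<open>On the sparse event both orders have equal probability, and the complement vanishes as
  the grid is refined. An inequality is enough, since \<open>pair_swap\<close> supplies the reverse
  one.\<close>

lemma prob_out_counts_window:
  assumes ab: "a \<le> b" and I: "finite I"
    and \<alpha>: "\<And>i. i \<in> I \<Longrightarrow> \<alpha> i \<in> configs" "\<And>i x. i \<in> I \<Longrightarrow> x < a \<Longrightarrow> \<alpha> i x = 0"
    and v: "\<And>i. i \<in> I \<Longrightarrow> v i \<le> b"
  shows "prob {\<omega> \<in> space M. C (out_counts I \<alpha> u v (S1 \<omega>) (S2 \<omega>))}
    \<le> prob {\<omega> \<in> space M. C (out_counts I \<alpha> u v (S2 \<omega>) (S1 \<omega>))}"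
proof -
  interpret swap: poisson_pair M \<mu>2 \<mu>1 S2 S1 by (rule pair_swap)
  \<comment> \<open>Service cells must avoid the arrivals in the window and the ends of the tested
    intervals.\<close>
  define P where "P = (\<Union>i\<in>I. {x \<in> {a..<b}. \<alpha> i x \<noteq> 0}) \<union> u ` I \<union> v ` I"
  have "finite {x \<in> {a..<b}. \<alpha> i x \<noteq> 0}" if "i \<in> I" for i
    using \<alpha>(1)[OF that] by (rule finite_points) simp
  with I have P: "finite P" unfolding P_def by blast
  have P': "i \<in> I \<Longrightarrow> u i \<in> P \<and> v i \<in> P"
    "i \<in> I \<Longrightarrow> a \<le> x \<Longrightarrow> x < b \<Longrightarrow> \<alpha> i x \<noteq> 0 \<Longrightarrow> x \<in> P" for i x
    by (auto simp: P_def)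
  define E where "E = {\<omega> \<in> space M. C (out_counts I \<alpha> u v (S1 \<omega>) (S2 \<omega>))}"
  define F where "F = {\<omega> \<in> space M. C (out_counts I \<alpha> u v (S2 \<omega>) (S1 \<omega>))}"
  define G where "G n = {\<omega> \<in> space M. sparse a b n P (S1 \<omega>) (S2 \<omega>)}" for n
  have [measurable]: "E \<in> events" "F \<in> events"
    unfolding E_def F_def by (intro predE out_counts_measurable measurable_S I \<alpha>(1); assumption)+
  have [measurable]: "G n \<in> events" for n
  proof -
    have sum: "(\<lambda>\<omega>. points_in (S1 \<omega>) (cell a b n j) + points_in (S2 \<omega>) (cell a b n j))
        \<in> M \<rightarrow>\<^sub>M count_space UNIV" for j
      by measurable
    have "Measurable.pred M (\<lambda>\<omega>. (\<lambda>s. s \<le> 1 \<and> (P \<inter> cell a b n j \<noteq> {} \<longrightarrow> s = 0))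
        (points_in (S1 \<omega>) (cell a b n j) + points_in (S2 \<omega>) (cell a b n j)))" for j
      by (rule measurable_compose[OF sum]) simp
    then show ?thesis unfolding G_def sparse_def by measurable
  qed
  define K where "K = (b - a)\<^sup>2 * (\<mu>1\<^sup>2 + \<mu>2\<^sup>2 + \<mu>1 * \<mu>2) + real (card P) * (b - a) * (\<mu>1 + \<mu>2)"
  have "prob E - prob F \<le> K * inverse (real (Suc n))" for n
  proof -
    let ?W = "words a b (Suc n) P I \<alpha> u v C" and ?h = "(b - a) / real (Suc n)"
    have "prob (E \<inter> G (Suc n)) = exp (- ((\<mu>1 + \<mu>2) * (b - a)))
        * (\<Sum>w\<in>?W. (\<mu>1 * ?h) ^ count_list w First * (\<mu>2 * ?h) ^ count_list w Second)"
      unfolding E_def G_def Collect_conj_eq[symmetric]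
      by (subst prob_sparse_out_counts[OF ab _ \<alpha> v P', symmetric])
        (auto intro!: arg_cong[where f = prob])
    \<comment> \<open>The set \<open>?W\<close> speaks of letters and arrivals only, so it describes
      both orders of the servers; exchanging the orders exchanges just the weights.\<close>
    also have "(\<Sum>w\<in>?W. (\<mu>1 * ?h) ^ count_list w First * (\<mu>2 * ?h) ^ count_list w Second)
        = (\<Sum>w\<in>?W. (\<mu>2 * ?h) ^ count_list w First * (\<mu>1 * ?h) ^ count_list w Second)"
      by (rule sum_words_swap[OF finite_words flip_words])
    also have "exp (- ((\<mu>1 + \<mu>2) * (b - a))) * \<dots> = prob (F \<inter> G (Suc n))"
      unfolding F_def G_def sparse_commute[of _ _ _ _ "S1 _"] add.commute[of \<mu>1]
      by (subst swap.prob_sparse_out_counts[OF ab _ \<alpha> v P', symmetric])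
        (auto intro!: arg_cong[where f = prob])
    finally have eq: "prob (E \<inter> G (Suc n)) = prob (F \<inter> G (Suc n))" .
    have "prob E \<le> prob ((E \<inter> G (Suc n)) \<union> (space M - G (Suc n)))"
    proof (rule finite_measure_mono)
      show "E \<subseteq> E \<inter> G (Suc n) \<union> (space M - G (Suc n))" by (auto simp: E_def)
    qed measurable
    also have "\<dots> \<le> prob (E \<inter> G (Suc n)) + prob (space M - G (Suc n))"
      by (rule measure_Un_le) auto
    also have "prob (E \<inter> G (Suc n)) \<le> prob F" unfolding eq by (rule finite_measure_mono) auto
    also have "space M - G (Suc n) = {\<omega> \<in> space M. \<not> sparse a b (Suc n) P (S1 \<omega>) (S2 \<omega>)}"
      by (auto simp: G_def)
    also have "prob \<dots> \<le> K * inverse (real (Suc n))"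
      using prob_not_sparse[OF ab _ P, of "Suc n"] by (simp add: K_def field_simps del: of_nat_Suc)
    finally show ?thesis by simp
  qed
  moreover have "(\<lambda>n. K * inverse (real (Suc n))) \<longlonglongrightarrow> K * 0"
    by (intro tendsto_mult tendsto_const LIMSEQ_inverse_real_of_nat)
  ultimately have "prob E - prob F \<le> K * 0" by (intro LIMSEQ_le_const) auto
  then show ?thesis by (simp add: E_def F_def)
qed

lemma prob_out_counts_swap:
  assumes I: "finite I" and \<alpha>: "\<And>i. i \<in> I \<Longrightarrow> \<alpha> i \<in> configs"
  shows "prob {\<omega> \<in> space M. C (out_counts I \<alpha> u v (S1 \<omega>) (S2 \<omega>))}
    = prob {\<omega> \<in> space M. C (out_counts I \<alpha> u v (S2 \<omega>) (S1 \<omega>))}"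
proof -
  interpret swap: poisson_pair M \<mu>2 \<mu>1 S2 S1 by (rule pair_swap)
  define T where "T k i x = (if - real k \<le> x then \<alpha> i x else 0)" for k i x
  have T: "i \<in> I \<Longrightarrow> T k i \<in> configs" for k i
    by (rule configs_subset[OF \<alpha>]) (simp_all add: T_def split: if_splits)
  \<comment> \<open>The sum bounds every \<open>v i\<close> and is non-negative even for empty
    \<open>I\<close>, so \<open>- real k \<le> b\<close> for all \<open>k\<close>.\<close>
  define b where "b = (\<Sum>i\<in>I. \<bar>v i\<bar>)"
  have b: "v i \<le> b" if "i \<in> I" for i
    using member_le_sum[of i I "\<lambda>i. \<bar>v i\<bar>"] that I unfolding b_def by auto
  have "b \<ge> 0" unfolding b_def by (intro sum_nonneg) simp
  then have b0: "- real k \<le> b" for k by (rule order_trans[rotated]) simp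
  have T0: "T k i x = 0" if "x < - real k" for k i x using that by (simp add: T_def)
  have eq: "prob {\<omega> \<in> space M. C (out_counts I (T k) u v (S1 \<omega>) (S2 \<omega>))}
    = prob {\<omega> \<in> space M. C (out_counts I (T k) u v (S2 \<omega>) (S1 \<omega>))}" for k
    by (rule antisym[OF prob_out_counts_window[OF b0[of k] I T T0 b]
        swap.prob_out_counts_window[OF b0[of k] I T T0 b]])
  have lim: "(\<lambda>k. prob {\<omega> \<in> space M. C (out_counts I (T k) u v (X \<omega>) (Y \<omega>))})
      \<longlonglongrightarrow> prob {\<omega> \<in> space M. C (out_counts I \<alpha> u v (X \<omega>) (Y \<omega>))}"
    if XY: "X \<in> M \<rightarrow>\<^sub>M config_space" "Y \<in> M \<rightarrow>\<^sub>M config_space" for X Y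
  proof (rule prob_tendsto_eventually)
    show "{\<omega> \<in> space M. C (out_counts I (T k) u v (X \<omega>) (Y \<omega>))} \<in> events"
      "{\<omega> \<in> space M. C (out_counts I \<alpha> u v (X \<omega>) (Y \<omega>))} \<in> events" for k
      by (intro predE out_counts_measurable XY I \<alpha> T; assumption)+
    fix \<omega> assume \<omega>: "\<omega> \<in> space M"
    have XY': "X \<omega> \<in> configs" "Y \<omega> \<in> configs"
      using measurable_space[OF XY(1) \<omega>] measurable_space[OF XY(2) \<omega>] by simp_all
    have "eventually (\<lambda>k. points_in (departures (departures (T k i) (X \<omega>)) (Y \<omega>)) {u i..<v i}
        = points_in (departures (departures (\<alpha> i) (X \<omega>)) (Y \<omega>)) {u i..<v i}) sequentially"
      if "i \<in> I" for i
    proof (rule locally_tends_points_in)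
      have "locally_tends (\<lambda>k. T k i) (\<alpha> i)"
        unfolding T_def by (rule locally_tends_truncate)
      then show "locally_tends (\<lambda>k. departures (departures (T k i) (X \<omega>)) (Y \<omega>))
          (departures (departures (\<alpha> i) (X \<omega>)) (Y \<omega>))"
        by (intro locally_tends_departures departures_in_configs XY' \<alpha> that)
    qed
    then have "eventually (\<lambda>k. \<forall>i\<in>I. points_in (departures (departures (T k i) (X \<omega>)) (Y \<omega>)) {u i..<v i}
        = points_in (departures (departures (\<alpha> i) (X \<omega>)) (Y \<omega>)) {u i..<v i}) sequentially"
      using I by (intro eventually_ball_finite) auto
    then show "eventually (\<lambda>k. \<omega> \<in> {\<omega> \<in> space M. C (out_counts I (T k) u v (X \<omega>) (Y \<omega>))}
        \<longleftrightarrow> \<omega> \<in> {\<omega> \<in> space M. C (out_counts I \<alpha> u v (X \<omega>) (Y \<omega>))}) sequentially"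
    proof (rule eventually_mono)
      fix k assume "\<forall>i\<in>I. points_in (departures (departures (T k i) (X \<omega>)) (Y \<omega>)) {u i..<v i}
        = points_in (departures (departures (\<alpha> i) (X \<omega>)) (Y \<omega>)) {u i..<v i}"
      then have "out_counts I (T k) u v (X \<omega>) (Y \<omega>) = out_counts I \<alpha> u v (X \<omega>) (Y \<omega>)"
        unfolding out_counts_def by (intro restrict_ext) auto
      then show "\<omega> \<in> {\<omega> \<in> space M. C (out_counts I (T k) u v (X \<omega>) (Y \<omega>))}
        \<longleftrightarrow> \<omega> \<in> {\<omega> \<in> space M. C (out_counts I \<alpha> u v (X \<omega>) (Y \<omega>))}" by simp
    qed
  qed
  show ?thesis
    using lim[OF measurable_S(1,2)] lim[OF measurable_S(2,1)] unfolding eq by (rule LIMSEQ_unique)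
qed

end

section \<open>Finite-dimensional cylinders of the multi-type space\<close>

definition count_cylinder :: "nat \<Rightarrow> (nat \<times> real \<times> real \<times> nat) list \<Rightarrow> (nat \<Rightarrow> config) set" where
  "count_cylinder m L = {z \<in> space (multi_space m). \<forall>(r, u, v, k)\<in>set L. points_in (z r) {u..<v} = k}"

definition count_cylinders :: "nat \<Rightarrow> (nat \<Rightarrow> config) set set" where
  "count_cylinders m = {count_cylinder m L | L. \<forall>(r, u, v, k)\<in>set L. r \<in> {1..m}}"

text \<open>With constraints kept in lists, intersection is concatenation and the empty list gives
  the whole space.\<close>

lemma count_cylinder_append:
  "count_cylinder m (L @ L') = count_cylinder m L \<inter> count_cylinder m L'"
  unfolding count_cylinder_def set_append ball_Un set_eq_iff mem_Collect_eq Int_iff by iprover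

lemma Int_stable_count_cylinders: "Int_stable (count_cylinders m)"
proof (rule Int_stableI)
  fix a b assume "a \<in> count_cylinders m" "b \<in> count_cylinders m"
  then obtain L L' where "a = count_cylinder m L" "b = count_cylinder m L'"
    and "\<forall>(r, u, v, k)\<in>set (L @ L'). r \<in> {1..m}"
    unfolding count_cylinders_def set_append ball_Un mem_Collect_eq by iprover
  then show "a \<inter> b \<in> count_cylinders m"
    unfolding count_cylinders_def by (auto simp: count_cylinder_append[symmetric] simp del: set_append)
qed

lemma measurable_component_multi:
  "r \<in> {1..m} \<Longrightarrow> (\<lambda>z. z r) \<in> multi_space m \<rightarrow>\<^sub>M config_space"
  unfolding multi_space_def by (rule measurable_component_singleton)

lemma count_cylinder_sets:
  assumes "\<forall>(r, u, v, k)\<in>set L. r \<in> {1..m}"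
  shows "count_cylinder m L \<in> sets (multi_space m)"
  using assms
proof (induction L)
  case Nil
  show ?case by (simp add: count_cylinder_def)
next
  case (Cons x L)
  obtain r u v k where x: "x = (r, u, v, k)" by (cases x)
  have [measurable]: "(\<lambda>z. points_in (z r) {u..<v}) \<in> multi_space m \<rightarrow>\<^sub>M count_space UNIV"
    using Cons.prems by (intro measurable_compose[OF measurable_component_multi measurable_points_in]) (auto simp: x)
  have "count_cylinder m (x # L)
    = {z \<in> space (multi_space m). points_in (z r) {u..<v} = k} \<inter> count_cylinder m L"
    by (auto simp: count_cylinder_def x)
  moreover have "{z \<in> space (multi_space m). points_in (z r) {u..<v} = k} \<in> sets (multi_space m)"
    by measurable
  ultimately show ?case using Cons by auto
qed

text \<open>The inclusion from left to right says that the identity is measurable from the cylinder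
  sigma-algebra. Coordinatewise, \<open>measurable_configI\<close> asks only for counts of half-open
  intervals, and these are cylinders with one constraint.\<close>

lemma sets_multi_space:
  "sets (multi_space m) = sigma_sets (space (multi_space m)) (count_cylinders m)"
proof
  let ?N = "sigma (space (multi_space m)) (count_cylinders m)"
  have sub: "count_cylinders m \<subseteq> Pow (space (multi_space m))"
    by (auto simp: count_cylinders_def count_cylinder_def)
  then have N: "space ?N = space (multi_space m)"
    "sets ?N = sigma_sets (space (multi_space m)) (count_cylinders m)"
    by (simp_all add: space_measure_of_conv)
  have id: "(\<lambda>z r. z r) \<in> ?N \<rightarrow>\<^sub>M (\<Pi>\<^sub>M r\<in>{1..m}. config_space)"
  proof (rule measurable_PiM_single')
    fix r assume r: "r \<in> {1..m}"
    show "(\<lambda>z. z r) \<in> ?N \<rightarrow>\<^sub>M config_space"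
    proof (rule measurable_configI)
      show "(\<lambda>z. z r) \<in> space ?N \<rightarrow> configs"
        using multi_space_configs[OF _ r] by (auto simp: N)
      fix u v :: real
      have "{z \<in> space (multi_space m). points_in (z r) {u..<v} = k} \<in> sets ?N" for k
      proof -
        have "{z \<in> space (multi_space m). points_in (z r) {u..<v} = k} = count_cylinder m [(r, u, v, k)]"
          by (simp add: count_cylinder_def)
        also have "\<dots> \<in> count_cylinders m"
          unfolding count_cylinders_def using r by (intro CollectI exI[of _ "[(r, u, v, k)]"]) auto
        finally show ?thesis unfolding N by (rule sigma_sets.Basic)
      qed
      then show "(\<lambda>z. points_in (z r) {u..<v}) \<in> ?N \<rightarrow>\<^sub>M count_space UNIV"
        by (simp add: measurable_count_space_eq2_countable vimage_def Int_def conj_commute N)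
    qed
  next
    show "(\<lambda>z r. z r) \<in> space ?N \<rightarrow> (\<Pi>\<^sub>E r\<in>{1..m}. space config_space)"
      unfolding N by (simp add: multi_space_def space_PiM)
  qed
  show "sets (multi_space m) \<subseteq> sigma_sets (space (multi_space m)) (count_cylinders m)"
  proof
    fix E assume E: "E \<in> sets (multi_space m)"
    have "(\<lambda>z r. z r) -` E \<inter> space ?N = E" using sets.sets_into_space[OF E] by (auto simp: N)
    with measurable_sets[OF id E[unfolded multi_space_def]]
    show "E \<in> sigma_sets (space (multi_space m)) (count_cylinders m)"
      by (simp only: N)
  qed
  show "sigma_sets (space (multi_space m)) (count_cylinders m) \<subseteq> sets (multi_space m)"
    unfolding count_cylinders_def by (rule sets.sigma_sets_subset) (blast intro: count_cylinder_sets)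
qed

section \<open>Reduction of the multi-type tandem to single-type tandems\<close>

lemma multi_departures_in_space:
  assumes "S \<in> configs" shows "multi_departures m a S \<in> space (multi_space m)"
  using multi_departures_in_configs[OF assms]
  by (auto simp: multi_space_def space_PiM PiE_def multi_departures_def)

text \<open>By \<open>sum_multi_departures\<close>, each cumulative class passes through both
  servers as a single-type tandem fed by \<open>upto_class a r\<close>. A class is the difference of
  two cumulative ones, so \<open>I\<close> also contains the indices with \<open>r - 1\<close>;
  index 0 stands for empty arrivals.\<close>

lemma tandem_in_count_cylinder_iff:
  assumes a: "a \<in> space (multi_space m)" and S1: "S1 \<in> configs" and S2: "S2 \<in> configs"
    and L: "\<forall>(r, u, v, k)\<in>set L. r \<in> {1..m}"
    and I: "I = (\<lambda>(r, u, v, k). (r, u, v)) ` set L \<union> (\<lambda>(r, u, v, k). (r - 1, u, v)) ` set L"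
  shows "multi_departures m (multi_departures m a S1) S2 \<in> count_cylinder m L \<longleftrightarrow>
    (\<forall>(r, u, v, k)\<in>set L.
      out_counts I (\<lambda>(r, u, v). upto_class a r) (\<lambda>(r, u, v). u) (\<lambda>(r, u, v). v) S1 S2 (r, u, v)
      - out_counts I (\<lambda>(r, u, v). upto_class a r) (\<lambda>(r, u, v). u) (\<lambda>(r, u, v). v) S1 S2 (r - 1, u, v) = k)"
proof -
  let ?c = "out_counts I (\<lambda>(r, u, v). upto_class a r) (\<lambda>(r, u, v). u) (\<lambda>(r, u, v). v) S1 S2"
  have "points_in (multi_departures m (multi_departures m a S1) S2 r) {u..<v} = ?c (r, u, v) - ?c (r - 1, u, v)"
    if x: "(r, u, v, k) \<in> set L" for r u v k
  proof -
    have r: "r \<in> {1..m}" using L x by auto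
    have "upto_class (multi_departures m a S1) r' = departures (upto_class a r') S1" if "r' \<le> m" for r'
      using sum_multi_departures[of m a r' S1] multi_space_configs[OF a] that
      by (simp add: departures_upto_eq)
    moreover have "r \<le> m" "r - 1 \<le> m" using r by auto
    ultimately have "points_in (multi_departures m (multi_departures m a S1) S2 r) {u..<v}
      = points_in (departures (departures (upto_class a r) S1) S2) {u..<v}
      - points_in (departures (departures (upto_class a (r - 1)) S1) S2) {u..<v}"
      using points_in_multi_departures[OF multi_departures_in_space[OF S1] S2 r] by simp
    moreover have "(r, u, v) \<in> I" "(r - 1, u, v) \<in> I" using x unfolding I by force+
    ultimately show ?thesis by (simp add: out_counts_def)
  qed
  then show ?thesis
    using multi_departures_in_space[OF S2, of m "multi_departures m a S1"]
    by (fastforce simp: count_cylinder_def)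
qed

lemma (in prob_space) distr_pair_indep:
  assumes "indep_elements M N X N' Y"
  shows "distr M N X \<Otimes>\<^sub>M distr M N' Y = distr M (N \<Otimes>\<^sub>M N') (\<lambda>\<omega>. (X \<omega>, Y \<omega>))"
proof -
  have X [measurable]: "X \<in> M \<rightarrow>\<^sub>M N" and Y [measurable]: "Y \<in> M \<rightarrow>\<^sub>M N'"
    and ind: "indep_set {X -` E \<inter> space M |E. E \<in> sets N} {Y -` F \<inter> space M |F. F \<in> sets N'}"
    using assms by (auto simp: indep_elements_def)
  interpret dX: prob_space "distr M N X" by (rule prob_space_distr[OF X])
  interpret dY: prob_space "distr M N' Y" by (rule prob_space_distr[OF Y])
  show ?thesis
  proof (rule pair_measure_eqI)
    show "sigma_finite_measure (distr M N X)" "sigma_finite_measure (distr M N' Y)" by unfold_locales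
    fix E F assume "E \<in> sets (distr M N X)" "F \<in> sets (distr M N' Y)"
    then have EF [measurable]: "E \<in> sets N" "F \<in> sets N'" by simp_all
    have "emeasure (distr M (N \<Otimes>\<^sub>M N') (\<lambda>\<omega>. (X \<omega>, Y \<omega>))) (E \<times> F)
      = emeasure M ((X -` E \<inter> space M) \<inter> (Y -` F \<inter> space M))"
      by (subst emeasure_distr) (auto intro!: arg_cong[where f = "emeasure M"])
    also have "\<dots> = ennreal (prob (X -` E \<inter> space M) * prob (Y -` F \<inter> space M))"
      unfolding emeasure_eq_measure using EF by (subst indep_setD[OF ind]) auto
    also have "\<dots> = emeasure (distr M N X) E * emeasure (distr M N' Y) F"
      by (simp add: emeasure_distr emeasure_eq_measure ennreal_mult)
    finally show "emeasure (distr M N X) E * emeasure (distr M N' Y) F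
      = emeasure (distr M (N \<Otimes>\<^sub>M N') (\<lambda>\<omega>. (X \<omega>, Y \<omega>))) (E \<times> F)" by simp
  qed simp
qed

text \<open>For frozen arrivals \<open>prob_out_counts_swap\<close> exchanges the servers on every
  cylinder; independence of \<open>A\<close> from the pair of services allows integration over the
  law of \<open>A\<close>, and cylinders determine a probability measure.\<close>

theorem corollary2p5:
  fixes M :: "'a measure" and \<mu>1 \<mu>2 :: real and S1 S2 :: "'a \<Rightarrow> config"
    and m :: nat and A :: "'a \<Rightarrow> nat \<Rightarrow> config"
  assumes "prob_space M"
    and "\<mu>1 > 0" and "\<mu>2 > 0"
    and "poisson_process M \<mu>1 S1" and "poisson_process M \<mu>2 S2"
    and "indep_elements M config_space S1 config_space S2"
    and "m \<ge> 1"
    and "A \<in> M \<rightarrow>\<^sub>M multi_space m"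
    and "indep_elements M (multi_space m) A
           (config_space \<Otimes>\<^sub>M config_space) (\<lambda>\<omega>. (S1 \<omega>, S2 \<omega>))"
  shows "same_distribution M (multi_space m)
           (\<lambda>\<omega>. multi_departures m (multi_departures m (A \<omega>) (S1 \<omega>)) (S2 \<omega>))
           (\<lambda>\<omega>. multi_departures m (multi_departures m (A \<omega>) (S2 \<omega>)) (S1 \<omega>))"
proof -
  interpret prob_space M by fact
  interpret poisson_pair M \<mu>1 \<mu>2 S1 S2
    using assms by unfold_locales auto
  let ?C = "config_space \<Otimes>\<^sub>M config_space"
  define D12 where "D12 = (\<lambda>(a, s1, s2). multi_departures m (multi_departures m a s1) s2)"
  define D21 where "D21 = (\<lambda>(a, s1, s2). multi_departures m (multi_departures m a s2) s1)"
  define Z where "Z \<omega> = (A \<omega>, S1 \<omega>, S2 \<omega>)" for \<omega>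
  note A = assms(8)
  have D [measurable]: "D12 \<in> multi_space m \<Otimes>\<^sub>M ?C \<rightarrow>\<^sub>M multi_space m"
    "D21 \<in> multi_space m \<Otimes>\<^sub>M ?C \<rightarrow>\<^sub>M multi_space m"
    unfolding D12_def D21_def split_beta by (intro measurable_multi_departures; measurable)+
  have Z [measurable]: "Z \<in> M \<rightarrow>\<^sub>M multi_space m \<Otimes>\<^sub>M ?C"
    unfolding Z_def using A by measurable
  have joint: "distr M (multi_space m \<Otimes>\<^sub>M ?C) Z
    = distr M (multi_space m) A \<Otimes>\<^sub>M distr M ?C (\<lambda>\<omega>. (S1 \<omega>, S2 \<omega>))"
    unfolding Z_def by (rule distr_pair_indep[OF assms(9), symmetric])
  interpret dS: prob_space "distr M ?C (\<lambda>\<omega>. (S1 \<omega>, S2 \<omega>))"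
    by (rule prob_space_distr) measurable
  have slice: "emeasure M {\<omega> \<in> space M. D12 (a, S1 \<omega>, S2 \<omega>) \<in> E}
      = emeasure M {\<omega> \<in> space M. D21 (a, S1 \<omega>, S2 \<omega>) \<in> E}"
    if a: "a \<in> space (multi_space m)" and E: "E \<in> count_cylinders m" for a E
  proof -
    obtain L where L: "E = count_cylinder m L" "\<forall>(r, u, v, k)\<in>set L. r \<in> {1..m}"
      using E by (auto simp: count_cylinders_def)
    define I where "I = (\<lambda>(r, u, v, k). (r, u, v)) ` set L \<union> (\<lambda>(r, u, v, k). (r - 1, u, v)) ` set L"
    define Q where "Q c \<longleftrightarrow> (\<forall>(r, u, v, k)\<in>set L. c (r, u, v) - c (r - 1, u, v) = k)"
      for c :: "nat \<times> real \<times> real \<Rightarrow> nat"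
    let ?c = "out_counts I (\<lambda>(r, u, v). upto_class a r) (\<lambda>(r, u, v). u) (\<lambda>(r, u, v). v)"
    have "finite I" by (simp add: I_def)
    moreover have "(\<lambda>(r, u, v). upto_class a r) i \<in> configs" if "i \<in> I" for i
    proof -
      have "fst i \<le> m" using that L(2) by (fastforce simp: I_def)
      then have "upto_class a (fst i) \<in> configs"
        using multi_space_configs[OF a] by (intro upto_class_in_configs) simp
      then show ?thesis by (simp add: split_beta)
    qed
    ultimately have "prob {\<omega> \<in> space M. Q (?c (S1 \<omega>) (S2 \<omega>))} = prob {\<omega> \<in> space M. Q (?c (S2 \<omega>) (S1 \<omega>))}"
      by (rule prob_out_counts_swap)
    moreover have "{\<omega> \<in> space M. D12 (a, S1 \<omega>, S2 \<omega>) \<in> E} = {\<omega> \<in> space M. Q (?c (S1 \<omega>) (S2 \<omega>))}"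
      "{\<omega> \<in> space M. D21 (a, S1 \<omega>, S2 \<omega>) \<in> E} = {\<omega> \<in> space M. Q (?c (S2 \<omega>) (S1 \<omega>))}"
      unfolding D12_def D21_def L(1) Q_def prod.case
      using tandem_in_count_cylinder_iff[OF a S_configs(1) S_configs(2) L(2) I_def]
        tandem_in_count_cylinder_iff[OF a S_configs(2) S_configs(1) L(2) I_def] by auto
    ultimately show ?thesis by (simp add: emeasure_eq_measure)
  qed
  \<comment> \<open>Fubini for the product law \<open>joint\<close>: the inner integrand is the
    probability of the section at \<open>a\<close>.\<close>
  have em: "emeasure (distr M (multi_space m) (\<lambda>\<omega>. D (Z \<omega>))) E
      = (\<integral>\<^sup>+a. emeasure M {\<omega> \<in> space M. D (a, S1 \<omega>, S2 \<omega>) \<in> E} \<partial>distr M (multi_space m) A)"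
    if D [measurable]: "D \<in> multi_space m \<Otimes>\<^sub>M ?C \<rightarrow>\<^sub>M multi_space m" and E [measurable]: "E \<in> sets (multi_space m)"
    for D E
  proof -
    let ?E = "D -` E \<inter> space (multi_space m \<Otimes>\<^sub>M ?C)"
    have E': "?E \<in> sets (multi_space m \<Otimes>\<^sub>M ?C)" by measurable
    have "emeasure (distr M (multi_space m) (\<lambda>\<omega>. D (Z \<omega>))) E = emeasure (distr M (multi_space m \<Otimes>\<^sub>M ?C) Z) ?E"
      using measurable_space[OF Z]
      by (subst (1 2) emeasure_distr) (auto intro!: arg_cong[where f = "emeasure M"])
    also have "\<dots> = (\<integral>\<^sup>+a. emeasure (distr M ?C (\<lambda>\<omega>. (S1 \<omega>, S2 \<omega>))) (Pair a -` ?E) \<partial>distr M (multi_space m) A)"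
      unfolding joint using E'
      by (intro dS.emeasure_pair_measure_alt) (simp cong: sets_pair_measure_cong)
    also have "\<dots> = (\<integral>\<^sup>+a. emeasure M {\<omega> \<in> space M. D (a, S1 \<omega>, S2 \<omega>) \<in> E} \<partial>distr M (multi_space m) A)"
    proof (rule nn_integral_cong)
      fix a assume "a \<in> space (distr M (multi_space m) A)"
      then have a: "a \<in> space (multi_space m)" by simp
      have "Pair a -` ?E \<in> sets ?C" using E' by (rule sets_Pair1)
      then show "emeasure (distr M ?C (\<lambda>\<omega>. (S1 \<omega>, S2 \<omega>))) (Pair a -` ?E)
        = emeasure M {\<omega> \<in> space M. D (a, S1 \<omega>, S2 \<omega>) \<in> E}"
        using a S_configs
        by (subst emeasure_distr) (auto simp: space_pair_measure intro!: arg_cong[where f = "emeasure M"])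
    qed
    finally show ?thesis .
  qed
  have "distr M (multi_space m) (\<lambda>\<omega>. D12 (Z \<omega>)) = distr M (multi_space m) (\<lambda>\<omega>. D21 (Z \<omega>))"
  proof (rule measure_eqI_generator_eq[OF Int_stable_count_cylinders[of m], where A = "\<lambda>_. space (multi_space m)"])
    show "count_cylinders m \<subseteq> Pow (space (multi_space m))"
      by (auto simp: count_cylinders_def count_cylinder_def)
    show "range (\<lambda>_::nat. space (multi_space m)) \<subseteq> count_cylinders m"
      by (auto simp: count_cylinders_def count_cylinder_def intro!: exI[of _ "[]"])
    fix E assume E: "E \<in> count_cylinders m"
    then have E': "E \<in> sets (multi_space m)" unfolding sets_multi_space by (rule sigma_sets.Basic)
    show "emeasure (distr M (multi_space m) (\<lambda>\<omega>. D12 (Z \<omega>))) E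
      = emeasure (distr M (multi_space m) (\<lambda>\<omega>. D21 (Z \<omega>))) E"
      unfolding em[OF D(1) E'] em[OF D(2) E'] using slice[OF _ E] by (intro nn_integral_cong) simp
  next
    interpret d: prob_space "distr M (multi_space m) (\<lambda>\<omega>. D12 (Z \<omega>))"
      by (rule prob_space_distr) measurable
    show "emeasure (distr M (multi_space m) (\<lambda>\<omega>. D12 (Z \<omega>))) (space (multi_space m)) \<noteq> \<infinity>"
      by simp
  qed (simp_all add: sets_multi_space)
  moreover have "(\<lambda>\<omega>. D12 (Z \<omega>)) \<in> M \<rightarrow>\<^sub>M multi_space m" "(\<lambda>\<omega>. D21 (Z \<omega>)) \<in> M \<rightarrow>\<^sub>M multi_space m"
    by measurable
  ultimately show ?thesis
    by (simp add: same_distribution_def D12_def D21_def Z_def)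
qed

end
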